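(* There exists a positive constant $c$ such that for every $n$ and every graph $F\in\mathcal{B}_n$, $$R_{\mathrm{ind}}^{\Delta}(F)\leq 2^{2^{cn\log n}}.$$
   Context: All graphs are finite and simple. $\mathcal{B}_n$ is the family of graphs $F$ on $n$ vertices for which there exists a bipartition $V(F)=A\cup B$ of the vertices such that the induced subgraph $F[A]$ is triangle-free, $B$ is an independent set, and the bipartite graph between $A$ and $B$ is arbitrary. For graphs $G,F$, write $G\overset{\mathrm{ind}}{\rightarrow}(F)^{\Delta}$ if for every $2$-coloring of the triangles of $G$ there is an induced copy of $F$ in $G$ all of whose triangles have the same color. $R_{\mathrm{ind}}^{\Delta}(F)$ is the smallest integer $N$ such that there exists a graph $G$ on $N$ vertices with $G\overset{\mathrm{ind}}{\rightarrow}(F)^{\Delta}$. *)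

theory Defs
  imports Complex_Main "HOL-Library.Ramsey" "HOL-Library.Extended_Real"
begin

type_synonym 'a graph = "'a set \<times> 'a set set"

abbreviation verts :: "'a graph \<Rightarrow> 'a set" where "verts G \<equiv> fst G"
abbreviation edges :: "'a graph \<Rightarrow> 'a set set" where "edges G \<equiv> snd G"

definition fin_simple_graph :: "'a graph \<Rightarrow> bool" where
  "fin_simple_graph G \<longleftrightarrow> finite (verts G) \<and> edges G \<subseteq> [verts G]\<^bsup>2\<^esup>"

definition induced_subgraph :: "'a graph \<Rightarrow> 'a set \<Rightarrow> 'a graph" where
  "induced_subgraph G W = (W, {e \<in> edges G. e \<subseteq> W})"

definition graph_iso :: "'a graph \<Rightarrow> 'b graph \<Rightarrow> bool" where
  "graph_iso G H \<longleftrightarrow> (\<exists>f. bij_betw f (verts G) (verts H) \<and>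
     (\<forall>u\<in>verts G. \<forall>v\<in>verts G. {u, v} \<in> edges G \<longleftrightarrow> {f u, f v} \<in> edges H))"

definition triangles :: "'a graph \<Rightarrow> 'a set set" where
  "triangles G = {T \<in> [verts G]\<^bsup>3\<^esup>. clique T (edges G)}"

definition triangle_free :: "'a graph \<Rightarrow> bool" where
  "triangle_free G \<longleftrightarrow> triangles G = {}"

definition family_B :: "nat \<Rightarrow> 'a graph set" where
  "family_B n = {F. fin_simple_graph F \<and> card (verts F) = n \<and>
     (\<exists>A B. A \<union> B = verts F \<and> A \<inter> B = {} \<and>
        triangle_free (induced_subgraph F A) \<and> indep B (edges F))}"

definition ind_triangle_arrow :: "'a graph \<Rightarrow> 'b graph \<Rightarrow> bool" where
  "ind_triangle_arrow G F \<longleftrightarrow> (\<forall>col :: 'a set \<Rightarrow> bool.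
     \<exists>W \<subseteq> verts G. graph_iso F (induced_subgraph G W) \<and>
       (\<exists>k. \<forall>T \<in> triangles (induced_subgraph G W). col T = k))"

text \<open>
  The infimum is taken in \<^typ>\<open>enat\<close>, so it is \<^term>\<open>\<infinity>\<close> when no suitable \<open>G\<close> exists and
  otherwise is attained; a finite upper bound therefore includes the existence of such a \<open>G\<close>.
  Vertices of \<open>G\<close> may be taken in \<^typ>\<open>nat\<close>, as every finite graph has an isomorphic copy there.
\<close>
definition R_ind_triangle :: "'a graph \<Rightarrow> enat" where
  "R_ind_triangle F = Inf {enat N | N. \<exists>G :: nat graph.
     fin_simple_graph G \<and> card (verts G) = N \<and> ind_triangle_arrow G F}"

end

theory Submission
  imports Defs "HOL-Library.FuncSet"
begin

text \<open>
  Let \<open>\<Gamma>\<close> be a graph on a set \<open>V\<close> of \<open>L\<close> vertices such that every 2-colouring of its edges contains a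
  monochromatic induced copy of \<open>F[A]\<close>. Blow up every \<open>l \<in> V\<close> to an independent set \<open>{l} \<times> [q]\<close> and add,
  for every transversal \<open>\<sigma> : V \<rightarrow> [q]\<close>, a vertex joined exactly to the points \<open>(l, \<sigma> l)\<close>. A colouring of
  the triangles gives each \<open>\<sigma>\<close> a colouring of the pairs of \<open>V\<close>; a set \<open>S\<close> of at least a \<open>2 ^ (- L\<^sup>2)\<close>
  proportion of the transversals gets the same one. If \<open>q\<close> is large compared with \<open>2 ^ L\<^sup>2\<close>, some
  \<open>x \<in> S\<close> is such that every proper subset of \<open>V\<close> is the agreement set of \<open>x\<close> with many \<open>\<sigma> \<in> S\<close>.
  A monochromatic copy of \<open>F[A]\<close> in \<open>V\<close>, lifted along \<open>x\<close>, then extends to a copy of \<open>F\<close>: each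
  \<open>b \<in> B\<close> is sent to a \<open>\<sigma>\<close> which agrees with \<open>x\<close> exactly on the neighbours of \<open>b\<close>. Every triangle of
  \<open>F\<close> has two vertices in \<open>A\<close> and one in \<open>B\<close>, so all of them get the same colour. The resulting graph has
  \<open>2 ^ L ^ O(1)\<close> vertices.

  It remains to take \<open>L = n ^ O(n)\<close> (Conlon, Fox and Sudakov). Here \<open>\<Gamma>\<close> is the inner product graph
  over the field with two elements. If red is hereditarily dense at a small scale, a red copy is embedded
  greedily; otherwise there is a large pair of sets with few red edges between them. Iterating, and always
  testing the colour for which fewer vertices are still needed, gives parts with a total capacity of
  \<open>n\<close> vertices, each hereditarily dense in one common colour and with almost all edges of \<open>\<Gamma>\<close> between
  different parts in that colour. The numbers of needed vertices halve alternately, so the losses form a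
  geometric series.
\<close>

section \<open>The inner product graph over two elements\<close>

text \<open>Markov's inequality, by double counting the pairs with \<open>P w v\<close>. Keeping it
  free of division makes \<open>s = 0\<close> harmless.\<close>

lemma card_exceed_times_le:
  fixes s t :: real
  assumes "finite A" "finite B" "0 \<le> s"
    and t: "\<And>v. v \<in> A \<Longrightarrow> card {w \<in> B. P w v} \<le> t"
  shows "card {w \<in> B. s < card {v \<in> A. P w v}} * s \<le> card A * t"
proof -
  have "card {w \<in> B. s < card {v \<in> A. P w v}} * s
      = (\<Sum>w \<in> {w \<in> B. s < card {v \<in> A. P w v}}. s)" by simp
  also have "\<dots> \<le> (\<Sum>w \<in> {w \<in> B. s < card {v \<in> A. P w v}}. real (card {v \<in> A. P w v}))"
    by (rule sum_mono) auto
  also have "\<dots> \<le> (\<Sum>w \<in> B. real (card {v \<in> A. P w v}))"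
    using assms by (intro sum_mono2) auto
  also have "\<dots> = (\<Sum>w \<in> B. \<Sum>v | v \<in> A \<and> P w v. 1)" by simp
  also have "\<dots> = (\<Sum>v \<in> A. \<Sum>w | w \<in> B \<and> P w v. 1)"
    by (rule sum.swap_restrict) (use assms in auto)
  also have "\<dots> = (\<Sum>v \<in> A. real (card {w \<in> B. P w v}))" by simp
  also have "\<dots> \<le> (\<Sum>v \<in> A. t)" by (intro sum_mono t)
  finally show ?thesis by simp
qed

text \<open>For distinct \<open>x\<close> and \<open>y\<close>, toggling an element \<open>i\<close>
  of the symmetric difference pairs off the sets \<open>v\<close> with opposite signs.\<close>

lemma character_orthogonality:
  assumes x: "x \<subseteq> {..<d}" and y: "y \<subseteq> {..<d}"
  shows "(\<Sum>v \<in> Pow {..<d}. (-1::real) ^ card (x \<inter> v) * (-1) ^ card (y \<inter> v))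
       = (if x = y then 2 ^ d else 0)"
proof (cases "x = y")
  case True
  then show ?thesis by (simp add: power_add [symmetric] mult_2 [symmetric] card_Pow)
next
  case False
  have wlog: "(\<Sum>v \<in> Pow {..<d}. (-1::real) ^ card (x \<inter> v) * (-1) ^ card (y \<inter> v)) = 0"
    if "x \<subseteq> {..<d}" "y \<subseteq> {..<d}" "i \<in> x" "i \<notin> y" for x y and i :: nat
  proof -
    let ?g = "\<lambda>v. (-1::real) ^ card (x \<inter> v) * (-1) ^ card (y \<inter> v)"
    define S where "S = Pow ({..<d} - {i})"
    have fin: "finite x" "finite y" using that finite_subset by auto
    have i: "{..<d} = insert i ({..<d} - {i})" using that by auto
    have "Pow {..<d} = S \<union> insert i ` S"
      unfolding S_def using i Pow_insert by metis
    moreover have "S \<inter> insert i ` S = {}" by (auto simp: S_def)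
    moreover have "inj_on (insert i) S"
      by (auto simp: S_def inj_on_def)
    ultimately have "sum ?g (Pow {..<d}) = sum ?g S + (\<Sum>v\<in>S. ?g (insert i v))"
      by (simp add: sum.union_disjoint S_def sum.reindex)
    moreover have "?g (insert i v) = - ?g v" if "v \<in> S" for v
    proof -
      have "x \<inter> insert i v = insert i (x \<inter> v)" "y \<inter> insert i v = y \<inter> v" "i \<notin> x \<inter> v"
        using \<open>i \<in> x\<close> \<open>i \<notin> y\<close> that by (auto simp: S_def)
      then show ?thesis using fin by simp
    qed
    ultimately show ?thesis by (simp add: sum_negf)
  qed
  obtain i where "i \<in> x \<and> i \<notin> y \<or> i \<in> y \<and> i \<notin> x" using False by auto
  then show ?thesis
    using wlog [of x y i] wlog [of y x i] x y False by (auto simp: mult.commute)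
qed

text \<open>Second moment argument: \<open>s w\<close> is a sum of characters, so by orthogonality
  its squares add up to \<open>card D * 2 ^ d\<close>, while each deviating \<open>w\<close>
  contributes at least \<open>(2 * \<eta> * card D)\<^sup>2\<close>. One factor
  \<open>card D\<close> then cancels.\<close>

lemma parity_graph_deviation:
  fixes \<eta> :: real
  assumes D: "D \<subseteq> Pow {..<d}" and "0 \<le> \<eta>"
  shows "card {w \<in> Pow {..<d}. \<eta> * card D < \<bar>real (card {x \<in> D. odd (card (w \<inter> x))}) - card D / 2\<bar>}
           * (4 * \<eta>\<^sup>2 * card D) \<le> 2 ^ d"
proof (cases "card D = 0")
  case False
  let ?V = "Pow {..<d}"
  define s :: "nat set \<Rightarrow> real" where "s w = (\<Sum>x\<in>D. (-1) ^ card (x \<inter> w))" for w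
  have finD: "finite D" using D finite_subset by auto
  have s: "s w = real (card D) - 2 * real (card {x \<in> D. odd (card (w \<inter> x))})" for w
  proof -
    have "s w = (\<Sum>x\<in>D. 1 - 2 * (if odd (card (w \<inter> x)) then 1 else 0))"
      unfolding s_def by (intro sum.cong) (auto simp: Int_commute)
    also have "\<dots> = real (card D) - 2 * real (card {x \<in> D. odd (card (w \<inter> x))})"
      using finD by (simp add: sum_subtractf sum_distrib_left [symmetric] sum.inter_filter [symmetric])
    finally show ?thesis .
  qed
  let ?B = "{w \<in> ?V. \<eta> * card D < \<bar>real (card {x \<in> D. odd (card (w \<inter> x))}) - card D / 2\<bar>}"
  have "card ?B * (4 * \<eta>\<^sup>2 * card D * card D) = (\<Sum>w\<in>?B. (2 * \<eta> * card D)\<^sup>2)"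
    by (simp add: power2_eq_square)
  also have "\<dots> \<le> (\<Sum>w\<in>?B. (s w)\<^sup>2)"
  proof (rule sum_mono)
    fix w assume "w \<in> ?B"
    then have "2 * \<eta> * card D \<le> \<bar>s w\<bar>" unfolding s by (auto simp: abs_if split: if_splits)
    then show "(2 * \<eta> * card D)\<^sup>2 \<le> (s w)\<^sup>2"
      using \<open>0 \<le> \<eta>\<close> by (metis power2_abs power_mono mult_nonneg_nonneg of_nat_0_le_iff zero_le_numeral)
  qed
  also have "\<dots> \<le> (\<Sum>w\<in>?V. (s w)\<^sup>2)" by (intro sum_mono2) auto
  also have "\<dots> = (\<Sum>w\<in>?V. \<Sum>x\<in>D. \<Sum>y\<in>D. (-1) ^ card (x \<inter> w) * (-1) ^ card (y \<inter> w))"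
    by (simp add: s_def power2_eq_square sum_product)
  also have "\<dots> = (\<Sum>x\<in>D. \<Sum>y\<in>D. \<Sum>w\<in>?V. (-1) ^ card (x \<inter> w) * (-1) ^ card (y \<inter> w))"
    by (subst sum.swap) (intro sum.cong refl sum.swap)
  also have "\<dots> = (\<Sum>x\<in>D. \<Sum>y\<in>D. if x = y then 2 ^ d else 0)"
    using D by (intro sum.cong refl character_orthogonality) auto
  also have "\<dots> = card D * 2 ^ d" using finD by simp
  finally have "card D * (card ?B * (4 * \<eta>\<^sup>2 * card D)) \<le> card D * (2 ^ d :: real)"
    by (simp add: mult_ac)
  then show ?thesis using False by (simp add: mult_le_cancel_left)
qed auto

section \<open>Monochromatic induced copies\<close>

locale edge_coloured_graph =
  fixes V :: "'v set" and e :: "'v \<Rightarrow> 'v \<Rightarrow> bool" and red :: "'v \<Rightarrow> 'v \<Rightarrow> bool"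
  assumes finite_V: "finite V"
    and e_sym: "e x y \<longleftrightarrow> e y x"
    and red_sym: "red x y \<longleftrightarrow> red y x"
begin

text \<open>The point \<open>w\<close> itself is excluded because \<open>e\<close> may hold on the
  diagonal: a set of odd size has odd intersection with itself.\<close>

definition nb :: "bool \<Rightarrow> 'v \<Rightarrow> 'v set" where
  "nb \<kappa> w = {x \<in> V. x \<noteq> w \<and> e w x \<and> (red w x \<longleftrightarrow> \<kappa>)}"

text \<open>Asking for a single \<open>u\<close> is enough: taking for \<open>U\<close> all vertices
  with fewer than \<open>\<epsilon> * card W\<close> neighbours in \<open>W\<close> shows that these
  number less than \<open>\<theta> * card Y\<close>. When the property fails, it fails with a pair
  \<open>U\<close>, \<open>W\<close> in which every \<open>u\<close> has low degree.\<close>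

definition hered_dense :: "real \<Rightarrow> real \<Rightarrow> bool \<Rightarrow> 'v set \<Rightarrow> bool" where
  "hered_dense \<epsilon> \<theta> \<kappa> Y \<longleftrightarrow> (\<forall>U W. U \<subseteq> Y \<and> W \<subseteq> Y \<and> \<theta> * card Y \<le> card U \<and> \<theta> * card Y \<le> card W \<longrightarrow>
     (\<exists>u\<in>U. \<epsilon> * card W \<le> card (nb \<kappa> u \<inter> W)))"

text \<open>
  Position \<open>j\<close> belongs to the block of positions starting at \<open>st j\<close>: positions of one block share
  the same set, which has room for \<open>c j\<close> vertices, and a vertex of an earlier block has few neighbours of the
  wrong colour in the sets of later blocks.
\<close>

definition layered ::
  "real \<Rightarrow> (nat \<Rightarrow> real) \<Rightarrow> real \<Rightarrow> bool \<Rightarrow> nat \<Rightarrow> real \<Rightarrow> 'v set \<Rightarrow> (nat \<Rightarrow> 'v set) \<Rightarrow> (nat \<Rightarrow> nat) \<Rightarrow> (nat \<Rightarrow> nat) \<Rightarrow> bool"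
  where "layered \<epsilon> \<theta> \<delta> \<kappa> k m X Z st c \<longleftrightarrow>
    (\<forall>j<k. Z j \<subseteq> X \<and> m \<le> real (card (Z j)) \<and> j \<le> st j + c j \<and> c j \<le> k) \<and>
    (\<forall>j<k. \<forall>i<st j. i < j \<longrightarrow> (\<forall>w\<in>Z i. real (card (nb (\<not> \<kappa>) w \<inter> Z j)) \<le> \<delta> * real (card (Z j)))) \<and>
    (\<forall>j<k. \<forall>i<j. st j \<le> i \<longrightarrow> Z i = Z j \<and> c i = c j \<and> hered_dense \<epsilon> (\<theta> (c j)) \<kappa> (Z j))"

lemma nb_sym: "x \<in> V \<Longrightarrow> y \<in> V \<Longrightarrow> x \<in> nb \<kappa> y \<longleftrightarrow> y \<in> nb \<kappa> x"
  unfolding nb_def using e_sym red_sym by auto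

lemma layered_mono:
  fixes m m' :: real
  assumes "layered \<epsilon> \<theta> \<delta> \<kappa> k m X Z st c" "m' \<le> m" "X \<subseteq> X'"
  shows "layered \<epsilon> \<theta> \<delta> \<kappa> k m' X' Z st c"
proof -
  have "Z j \<subseteq> X' \<and> m' \<le> card (Z j)" if "j < k" for j
    using assms that unfolding layered_def by (meson order_trans)
  then show ?thesis using assms(1) unfolding layered_def by simp
qed

lemma layered_leaf:
  fixes m :: real
  assumes "hered_dense \<epsilon> (\<theta> k) \<kappa> X \<or> k \<le> 1" "m \<le> card X"
  shows "layered \<epsilon> \<theta> \<delta> \<kappa> k m X (\<lambda>_. X) (\<lambda>_. 0) (\<lambda>_. k)"
  using assms unfolding layered_def by auto

text \<open>The second family keeps its internal structure, with positions shifted by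
  \<open>k1\<close>. Degrees are controlled only from earlier blocks into later ones, so
  \<open>cross\<close> is one-sided.\<close>

lemma layered_append:
  fixes \<delta> m :: real
  assumes 1: "layered \<epsilon> \<theta> \<delta> \<kappa> k1 m X Z1 st1 c1" and 2: "layered \<epsilon> \<theta> \<delta> \<kappa> k2 m X Z2 st2 c2"
    and cross: "\<And>i j w. i < k1 \<Longrightarrow> j < k2 \<Longrightarrow> w \<in> Z1 i \<Longrightarrow> card (nb (\<not> \<kappa>) w \<inter> Z2 j) \<le> \<delta> * card (Z2 j)"
  shows "layered \<epsilon> \<theta> \<delta> \<kappa> (k1 + k2) m X
     (\<lambda>j. if j < k1 then Z1 j else Z2 (j - k1))
     (\<lambda>j. if j < k1 then st1 j else k1 + st2 (j - k1))
     (\<lambda>j. if j < k1 then c1 j else c2 (j - k1))"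
    (is "layered _ _ _ _ ?k _ _ ?Z ?st ?c")
  unfolding layered_def
proof (intro conjI allI impI ballI)
  fix j assume j: "j < k1 + k2"
  then have j2: "j - k1 < k2" if "\<not> j < k1" using that by linarith
  show "?Z j \<subseteq> X" "m \<le> card (?Z j)" "j \<le> ?st j + ?c j" "?c j \<le> ?k"
  proof -
    have "Z1 j \<subseteq> X \<and> m \<le> card (Z1 j) \<and> j \<le> st1 j + c1 j \<and> c1 j \<le> k1" if "j < k1"
      using 1 that unfolding layered_def by blast
    moreover have "Z2 (j - k1) \<subseteq> X \<and> m \<le> card (Z2 (j - k1)) \<and> j - k1 \<le> st2 (j - k1) + c2 (j - k1) \<and> c2 (j - k1) \<le> k2"
      if "\<not> j < k1"
      using 2 j2 [OF that] unfolding layered_def by blast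
    ultimately show "?Z j \<subseteq> X" "m \<le> card (?Z j)" "j \<le> ?st j + ?c j" "?c j \<le> ?k" by auto
  qed
  fix i
  show "card (nb (\<not> \<kappa>) w \<inter> ?Z j) \<le> \<delta> * card (?Z j)" if i: "i < ?st j" "i < j" and w: "w \<in> ?Z i" for w
  proof (cases "j < k1")
    case True
    then show ?thesis using 1 i w unfolding layered_def by auto
  next
    case False
    show ?thesis
    proof (cases "i < k1")
      case True
      then show ?thesis using cross [of i "j - k1" w] False w j2 by auto
    next
      case i1: False
      have "\<forall>w\<in>Z2 (i - k1). card (nb (\<not> \<kappa>) w \<inter> Z2 (j - k1)) \<le> \<delta> * card (Z2 (j - k1))"
      proof -
        have "i - k1 < st2 (j - k1)" "i - k1 < j - k1" using i i1 False by auto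
        then show ?thesis using 2 j2 [OF False] unfolding layered_def by blast
      qed
      then show ?thesis using w i1 False by auto
    qed
  qed
  show "?Z i = ?Z j" "?c i = ?c j" "hered_dense \<epsilon> (\<theta> (?c j)) \<kappa> (?Z j)" if i: "i < j" "?st j \<le> i"
  proof -
    have "?Z i = ?Z j \<and> ?c i = ?c j \<and> hered_dense \<epsilon> (\<theta> (?c j)) \<kappa> (?Z j)"
    proof (cases "j < k1")
      case True
      then show ?thesis using 1 i unfolding layered_def by auto
    next
      case False
      then have i1: "\<not> i < k1" "st2 (j - k1) \<le> i - k1" "i - k1 < j - k1" using i by auto
      then have "Z2 (i - k1) = Z2 (j - k1) \<and> c2 (i - k1) = c2 (j - k1) \<and>
          hered_dense \<epsilon> (\<theta> (c2 (j - k1))) \<kappa> (Z2 (j - k1))"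
        using 2 j2 [OF False] unfolding layered_def by blast
      then show ?thesis using i1 False by simp
    qed
    then show "?Z i = ?Z j" "?c i = ?c j" "hered_dense \<epsilon> (\<theta> (?c j)) \<kappa> (?Z j)" by auto
  qed
qed

text \<open>Double counting between \<open>Z j\<close> and \<open>W\<close>: the choice
  \<open>\<delta> = 2 * n * \<epsilon>\<close> makes at most a \<open>1 / (2 * n)\<close> share of
  \<open>W\<close> bad for each \<open>j\<close>, and there are at most \<open>n\<close> values of
  \<open>j\<close>, so half of \<open>W\<close> survives.\<close>

lemma layered_split:
  fixes \<epsilon> \<delta> :: real and n :: nat
  assumes "0 < \<epsilon>" "0 < n" and \<delta>: "\<delta> = 2 * n * \<epsilon>" and "k \<le> n" and "X \<subseteq> V"
    and UW: "U \<subseteq> X" "W \<subseteq> X" and low: "\<And>u. u \<in> U \<Longrightarrow> card (nb \<kappa> u \<inter> W) < \<epsilon> * card W"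
    and Z: "\<And>j. j < k \<Longrightarrow> Z j \<subseteq> U"
  defines "W' \<equiv> {w \<in> W. \<forall>j<k. card (nb \<kappa> w \<inter> Z j) \<le> \<delta> * card (Z j)}"
  shows "card W \<le> 2 * real (card W')"
proof -
  have fin: "finite W" "finite U" using UW \<open>X \<subseteq> V\<close> finite_V by (meson finite_subset)+
  define Bad where "Bad j = {w \<in> W. \<delta> * card (Z j) < card {u \<in> Z j. u \<in> nb \<kappa> w}}" for j
  have bad: "card (Bad j) * (2 * real n) \<le> card W" if "j < k" for j
  proof (cases "card (Z j) = 0")
    case True
    then have "Z j = {}" using Z [OF that] fin by (meson card_0_eq finite_subset)
    then show ?thesis by (simp add: Bad_def)
  next
    case False
    have "card (Bad j) * (\<delta> * card (Z j)) \<le> card (Z j) * (\<epsilon> * card W)"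
      unfolding Bad_def
    proof (rule card_exceed_times_le)
      show "finite (Z j)" using Z [OF that] fin finite_subset by blast
      show "0 \<le> \<delta> * card (Z j)" using \<open>0 < \<epsilon>\<close> \<delta> by simp
      fix u assume u: "u \<in> Z j"
      have "{w \<in> W. u \<in> nb \<kappa> w} = nb \<kappa> u \<inter> W"
        using u Z [OF that] UW \<open>X \<subseteq> V\<close> nb_sym by blast
      then show "card {w \<in> W. u \<in> nb \<kappa> w} \<le> \<epsilon> * card W"
        using low [of u] u Z [OF that] by force
    qed (use fin in auto)
    then have "(\<epsilon> * card (Z j)) * (card (Bad j) * (2 * real n)) \<le> (\<epsilon> * card (Z j)) * card W"
      unfolding \<delta> by (simp add: mult_ac)
    then show ?thesis using \<open>0 < \<epsilon>\<close> False by (simp add: mult_le_cancel_left)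
  qed
  have "W \<subseteq> W' \<union> (\<Union>j<k. Bad j)"
  proof
    fix w assume "w \<in> W"
    moreover have "{u \<in> Z j. u \<in> nb \<kappa> w} = nb \<kappa> w \<inter> Z j" for j by auto
    ultimately show "w \<in> W' \<union> (\<Union>j<k. Bad j)"
      unfolding W'_def Bad_def by (auto simp: not_le)
  qed
  then have "card W \<le> card (W' \<union> (\<Union>j<k. Bad j))"
    using fin by (intro card_mono) (auto simp: W'_def Bad_def)
  also have "\<dots> \<le> card W' + (\<Sum>j<k. card (Bad j))"
    by (intro order_trans [OF card_Un_le] add_left_mono card_UN_le) simp
  finally have "real (card W) \<le> card W' + (\<Sum>j<k. real (card (Bad j)))"
    by (simp flip: of_nat_sum of_nat_add)
  moreover have "(\<Sum>j<k. real (card (Bad j))) \<le> (\<Sum>j<k. card W / (2 * real n))"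
    using bad \<open>0 < n\<close> by (intro sum_mono) (auto simp: field_simps)
  moreover have "(\<Sum>j<k. card W / (2 * real n)) \<le> real (card W) / 2"
  proof -
    have "real k * card W \<le> real n * card W" using \<open>k \<le> n\<close> by (intro mult_right_mono) auto
    then show ?thesis using \<open>0 < n\<close> by (simp add: divide_simps mult_ac)
  qed
  ultimately show ?thesis by linarith
qed

text \<open>
  Testing density in the colour with the smaller target \<open>2 ^ a\<close> costs a factor \<open>p ^ 2 ^ a\<close> and
  halves the larger target; this alternation keeps the total loss at \<open>p ^ O(2 ^ a + 2 ^ b)\<close>.
\<close>

lemma ex_layered:
  fixes \<epsilon> \<delta> \<gamma> p :: real and n :: nat
  assumes \<epsilon>: "0 < \<epsilon>" and n: "0 < n" and \<delta>: "\<delta> = 2 * n * \<epsilon>" and p: "0 < p" "p \<le> 1" and \<gamma>: "0 < \<gamma>" "\<gamma> \<le> 1"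
    and \<theta>: "\<And>k. \<theta> k = \<gamma> * p ^ k"
  shows "2 ^ a \<le> n \<Longrightarrow> 2 ^ b \<le> n \<Longrightarrow> X \<subseteq> V \<Longrightarrow>
    (\<exists>Z st c. layered \<epsilon> \<theta> \<delta> \<kappa> (2 ^ a) ((\<gamma> / 2) ^ (a + b) * p ^ (2 * (2 ^ a + 2 ^ b)) * card X) X Z st c) \<or>
    (\<exists>Z st c. layered \<epsilon> \<theta> \<delta> (\<not> \<kappa>) (2 ^ b) ((\<gamma> / 2) ^ (a + b) * p ^ (2 * (2 ^ a + 2 ^ b)) * card X) X Z st c)"
proof (induction "a + b" arbitrary: a b X \<kappa> rule: less_induct)
  case less
  let ?f = "\<lambda>a b. (\<gamma> / 2) ^ (a + b) * p ^ (2 * (2 ^ a + 2 ^ b)) :: real"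
  have f1: "?f a b \<le> 1" for a b
    using p \<gamma> by (intro mult_le_one power_le_one) auto
  have f0: "0 < ?f a b" for a b using p \<gamma> by simp
  \<comment> \<open>The case \<open>a \<le> b\<close>, with the induction hypothesis as a premise,
    so that it can be used a second time with colours and exponents exchanged.\<close>
  have main: "(\<exists>Z st c. layered \<epsilon> \<theta> \<delta> \<kappa> (2 ^ a) (?f a b * card X) X Z st c) \<or>
    (\<exists>Z st c. layered \<epsilon> \<theta> \<delta> (\<not> \<kappa>) (2 ^ b) (?f a b * card X) X Z st c)"
    if IH: "\<And>a' b' X \<kappa>. a' + b' < a + b \<Longrightarrow> 2 ^ a' \<le> n \<Longrightarrow> 2 ^ b' \<le> n \<Longrightarrow> X \<subseteq> V \<Longrightarrow>
      (\<exists>Z st c. layered \<epsilon> \<theta> \<delta> \<kappa> (2 ^ a') (?f a' b' * card X) X Z st c) \<or>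
      (\<exists>Z st c. layered \<epsilon> \<theta> \<delta> (\<not> \<kappa>) (2 ^ b') (?f a' b' * card X) X Z st c)"
     and ab: "a \<le> b" and an: "2 ^ a \<le> n" and bn: "2 ^ b \<le> n" and X: "X \<subseteq> V" for a b \<kappa> X
  proof (cases "hered_dense \<epsilon> (\<theta> (2 ^ a)) \<kappa> X \<or> a = 0")
    case True
    have "?f a b * card X \<le> card X" using f1 [of a b] by (intro mult_left_le_one_le) (use f0 [of a b] in auto)
    then have "layered \<epsilon> \<theta> \<delta> \<kappa> (2 ^ a) (?f a b * card X) X (\<lambda>_. X) (\<lambda>_. 0) (\<lambda>_. 2 ^ a)"
      using True by (intro layered_leaf) auto
    then show ?thesis by blast
  next
    case False
    then obtain U W where U: "U \<subseteq> X" "\<theta> (2 ^ a) * card X \<le> card U" and W: "W \<subseteq> X" "\<theta> (2 ^ a) * card X \<le> card W"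
      and low: "\<And>u. u \<in> U \<Longrightarrow> card (nb \<kappa> u \<inter> W) < \<epsilon> * card W"
      unfolding hered_dense_def by (auto simp: not_le)
    obtain b' where b: "b = Suc b'" using False ab by (cases b) auto
    have b'n: "2 ^ b' \<le> n" using bn b by simp
    \<comment> \<open>One halving of the larger target is affordable: \<open>p ^ 2 ^ a\<close> fits
      since \<open>2 ^ a + 2 * 2 ^ b' \<le> 2 * 2 ^ b\<close>, and one factor
      \<open>\<gamma> / 2\<close> pays for the \<open>\<gamma>\<close> in \<open>\<theta>\<close>
      and for the half of \<open>W\<close> lost in passing to \<open>W'\<close>.\<close>
    have ff: "?f a b * card X \<le> ?f a b' * card Y" if "\<theta> (2 ^ a) * card X \<le> 2 * card Y" for Y :: "'v set"
    proof -
      have "2 * (2 ^ a + 2 ^ b) \<ge> 2 ^ a + 2 * (2 ^ a + 2 ^ b' :: nat)"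
        using ab power_increasing [of a b "2::nat"] by (simp add: b)
      then have "p ^ (2 * (2 ^ a + 2 ^ b)) \<le> p ^ (2 ^ a + 2 * (2 ^ a + 2 ^ b'))"
        using p by (intro power_decreasing) auto
      then have "?f a b * card X \<le> (\<gamma> / 2) ^ (a + b) * p ^ (2 ^ a + 2 * (2 ^ a + 2 ^ b')) * card X"
        using \<gamma> by (intro mult_right_mono mult_left_mono) auto
      also have "\<dots> = ?f a b' * (\<gamma> * p ^ (2 ^ a) * card X / 2)"
        unfolding b add_Suc_right power_Suc power_add [of p "2 ^ a"] by (simp add: mult_ac)
      also have "\<dots> \<le> ?f a b' * card Y"
        using that f0 [of a b'] by (intro mult_left_mono) (auto simp: \<theta>)
      finally show ?thesis .
    qed
    consider (1) "\<exists>Z st c. layered \<epsilon> \<theta> \<delta> \<kappa> (2 ^ a) (?f a b' * card U) U Z st c"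
      | (2) Z1 st1 c1 where "layered \<epsilon> \<theta> \<delta> (\<not> \<kappa>) (2 ^ b') (?f a b' * card U) U Z1 st1 c1"
      using IH [of a b' U \<kappa>] an b'n subset_trans [OF U(1) X] b by (simp only: add_Suc_right lessI simp_thms) metis
    then show ?thesis
    proof cases
      case 1
      have "?f a b * card X \<le> ?f a b' * card U" using U by (intro ff) auto
      then show ?thesis using 1 layered_mono U by blast
    next
      case 2
      \<comment> \<open>Having found half of the target in the other colour inside \<open>U\<close>,
        the search continues among the vertices of \<open>W\<close> that send few edges of colour
        \<open>\<kappa>\<close> to it.\<close>
      define W' where "W' = {w \<in> W. \<forall>j<2 ^ b'. card (nb \<kappa> w \<inter> Z1 j) \<le> \<delta> * card (Z1 j)}"
      have "card W \<le> 2 * real (card W')"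
        unfolding W'_def
      proof (rule layered_split [OF \<epsilon> n \<delta> b'n X U(1) W(1) low])
        show "Z1 j \<subseteq> U" if "j < 2 ^ b'" for j using 2 that unfolding layered_def by simp
      qed
      then have fW: "?f a b * card X \<le> ?f a b' * card W'" using W by (intro ff) auto
      have W'X: "W' \<subseteq> X" using W by (auto simp: W'_def)
      consider (3) "\<exists>Z st c. layered \<epsilon> \<theta> \<delta> \<kappa> (2 ^ a) (?f a b' * card W') W' Z st c"
        | (4) Z2 st2 c2 where "layered \<epsilon> \<theta> \<delta> (\<not> \<kappa>) (2 ^ b') (?f a b' * card W') W' Z2 st2 c2"
        using IH [of a b' W' \<kappa>] an b'n subset_trans [OF W'X X] b by (simp only: add_Suc_right lessI simp_thms) metis
      then show ?thesis
      proof cases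
        case 3
        then show ?thesis using fW layered_mono W'X by blast
      next
        case 4
        have fU: "?f a b * card X \<le> ?f a b' * card U" using U by (intro ff) auto
        \<comment> \<open>The half found in \<open>W'\<close> has to come first, since it is the
          degrees from \<open>W'\<close> into the sets \<open>Z1 j\<close> that are
          controlled.\<close>
        have "\<exists>Z st c. layered \<epsilon> \<theta> \<delta> (\<not> \<kappa>) (2 ^ b' + 2 ^ b') (?f a b * card X) X Z st c"
        proof (intro exI, rule layered_append)
          show "layered \<epsilon> \<theta> \<delta> (\<not> \<kappa>) (2 ^ b') (?f a b * card X) X Z2 st2 c2"
            by (rule layered_mono [OF 4 fW W'X])
          show "layered \<epsilon> \<theta> \<delta> (\<not> \<kappa>) (2 ^ b') (?f a b * card X) X Z1 st1 c1"
            by (rule layered_mono [OF 2 fU U(1)])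
          fix i j :: nat and w assume "i < 2 ^ b'" "j < 2 ^ b'" "w \<in> Z2 i"
          moreover have "w \<in> W'" using calculation 4 unfolding layered_def by blast
          ultimately show "card (nb (\<not> \<not> \<kappa>) w \<inter> Z1 j) \<le> \<delta> * card (Z1 j)"
            by (simp add: W'_def)
        qed
        then show ?thesis by (simp add: b mult_2)
      qed
    qed
  qed
  show ?case
  proof (cases "a \<le> b")
    case True
    show ?thesis
      by (rule main [OF _ True less.prems]) (rule less.hyps)
  next
    case False
    have "(\<exists>Z st c. layered \<epsilon> \<theta> \<delta> (\<not> \<kappa>) (2 ^ b) (?f b a * card X) X Z st c) \<or>
      (\<exists>Z st c. layered \<epsilon> \<theta> \<delta> (\<not> \<not> \<kappa>) (2 ^ a) (?f b a * card X) X Z st c)"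
    proof (rule main)
      show "b \<le> a" using False by simp
      fix a' b' X \<kappa>
      assume "a' + b' < b + a" "2 ^ a' \<le> n" "2 ^ b' \<le> n" "X \<subseteq> V"
      then show "(\<exists>Z st c. layered \<epsilon> \<theta> \<delta> \<kappa> (2 ^ a') (?f a' b' * card X) X Z st c) \<or>
        (\<exists>Z st c. layered \<epsilon> \<theta> \<delta> (\<not> \<kappa>) (2 ^ b') (?f a' b' * card X) X Z st c)"
        by (intro less.hyps) (simp_all only: add.commute [of a b])
    qed (rule less.prems)+
    moreover have "?f b a = ?f a b" by (simp add: add.commute)
    ultimately show ?thesis by auto
  qed
qed

section \<open>Greedy embedding into candidate sets\<close>

text \<open>
  The candidates in \<open>C i\<close> that would keep too many neighbours of the wrong colour in \<open>C j\<close> if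
  \<open>C j\<close> is restricted to the (non-)neighbours of \<open>w\<close>.
\<close>

definition violators :: "bool \<Rightarrow> real \<Rightarrow> (nat \<Rightarrow> 'v set) \<Rightarrow> bool \<Rightarrow> nat \<Rightarrow> nat \<Rightarrow> 'v \<Rightarrow> 'v set" where
  "violators \<kappa> t C s i j w = {v \<in> C i. t * card (C j) < card {x \<in> nb (\<not> \<kappa>) v \<inter> C j. e w x \<longleftrightarrow> s}}"

text \<open>Union bound over \<open>C 0\<close>: irregular degrees (\<open>dev\<close>), low degree
  inside the own block (\<open>Bad2\<close>) and too many violators (\<open>Bad3\<close>) exclude at
  most \<open>B / 4\<close>, \<open>b / 4\<close> and \<open>B / 4\<close> vertices, while
  \<open>B \<le> b \<le> card (C 0)\<close>.\<close>

lemma ex_good_vertex: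
  fixes n r :: nat and B \<delta> \<epsilon> \<eta> b :: real
  assumes n: "2 \<le> n" and r: "0 < r" "r \<le> n" and \<epsilon>: "\<epsilon> = 1 / (128 * (real n)\<^sup>2)" and \<eta>: "\<eta> = 1 / (16 * real n)"
    and deviation: "\<And>D. D \<subseteq> V \<Longrightarrow>
      card {w \<in> V. \<eta> * card D < \<bar>real (card {x \<in> D. e w x}) - card D / 2\<bar>} * (4 * \<eta>\<^sup>2 * card D) \<le> card V"
    and B: "0 < B" "2 ^ 24 * real n ^ 8 * real (card V) \<le> B\<^sup>2"
    and C: "\<And>j. j < r \<Longrightarrow> C j \<subseteq> V" "\<And>j. j < r \<Longrightarrow> B \<le> card (C j)" and b: "B \<le> b" "b \<le> card (C 0)"
    and \<delta>: "1 / (64 * real n) \<le> \<delta>"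
    and cross: "\<And>i j v. j < r \<Longrightarrow> i < j \<Longrightarrow> i < st j \<Longrightarrow> v \<in> C i \<Longrightarrow> card (nb (\<not> \<kappa>) v \<inter> C j) \<le> \<delta> * card (C j)"
    and same: "\<And>j. 0 < j \<Longrightarrow> j < r \<Longrightarrow> st j = 0 \<Longrightarrow> \<exists>\<tau>::real. 4 * real n * \<tau> \<le> b \<and> \<tau> \<le> card (C j) \<and>
      (\<forall>U W. U \<subseteq> C 0 \<and> W \<subseteq> C j \<and> \<tau> \<le> card U \<and> \<tau> \<le> card W \<longrightarrow> (\<exists>u\<in>U. \<epsilon> * card W \<le> card (nb \<kappa> u \<inter> W)))"
  obtains w where "w \<in> C 0"
    and "\<And>j. 0 < j \<Longrightarrow> j < r \<Longrightarrow> \<bar>real (card {x \<in> C j. e w x}) - card (C j) / 2\<bar> \<le> \<eta> * card (C j)"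
    and "\<And>j. 0 < j \<Longrightarrow> j < r \<Longrightarrow> st j = 0 \<Longrightarrow> \<epsilon> * card (C j) \<le> card (nb \<kappa> w \<inter> C j)"
    and "\<And>i j. j < r \<Longrightarrow> i < j \<Longrightarrow> i < st j \<Longrightarrow>
      card (violators \<kappa> ((1/2 + \<eta>) * \<delta>) C (s j) i j w) \<le> \<epsilon> / (4 * real n) * card (C i)"
proof -
  have n0: "0 < real n" using n by simp
  have \<eta>2: "4 * \<eta>\<^sup>2 = 1 / (64 * (real n)\<^sup>2)" by (simp add: \<eta> power_divide power_mult_distrib)
  have pos: "0 < \<epsilon>" "0 < \<eta>" "0 < \<delta>"
    using n0 \<epsilon> \<eta> \<delta> by (auto intro: less_le_trans [of 0 "1 / (64 * real n)"])
  define dev where "dev D = {w \<in> V. \<eta> * card D < \<bar>real (card {x \<in> D. e w x}) - card D / 2\<bar>}" for D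
  define Bad2 where "Bad2 j = {w \<in> C 0. card (nb \<kappa> w \<inter> C j) < \<epsilon> * card (C j)}" for j
  define Bad3 where "Bad3 i j = {w \<in> V. \<epsilon> / (4 * real n) * card (C i) < card (violators \<kappa> ((1/2 + \<eta>) * \<delta>) C (s j) i j w)}" for i j
  have dev: "card (dev D) * real (card D) \<le> 64 * (real n)\<^sup>2 * real (card V)" if "D \<subseteq> V" for D
    using deviation [OF that] n0 unfolding \<eta>2 dev_def [symmetric] by (simp add: field_simps)
  have b1: "card (dev (C j)) * B \<le> 64 * (real n)\<^sup>2 * real (card V)" if "j < r" for j
  proof -
    have "card (dev (C j)) * B \<le> card (dev (C j)) * real (card (C j))"
      using C(2) [OF that] by (intro mult_left_mono) auto
    then show ?thesis using dev [OF C(1) [OF that]] by linarith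
  qed
  \<comment> \<open>\<open>Bad2 j\<close> contains no vertex of large degree into
    \<open>C j\<close>, so \<open>rich\<close> forces it to have fewer than \<open>\<tau>\<close>
    elements, and \<open>\<tau>\<close> is at most \<open>b / (4 * n)\<close>.\<close>
  have b2: "card (Bad2 j) * (4 * real n) \<le> b" if j: "0 < j" "j < r" "st j = 0" for j
  proof -
    obtain \<tau> :: real where \<tau>: "4 * real n * \<tau> \<le> b" "\<tau> \<le> card (C j)"
      and rich: "\<forall>U W. U \<subseteq> C 0 \<and> W \<subseteq> C j \<and> \<tau> \<le> card U \<and> \<tau> \<le> card W \<longrightarrow>
        (\<exists>u\<in>U. \<epsilon> * card W \<le> card (nb \<kappa> u \<inter> W))"
      using same [OF j] by (elim exE conjE) (rule that)
    have "\<not> \<tau> \<le> card (Bad2 j)"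
    proof
      assume "\<tau> \<le> card (Bad2 j)"
      moreover have "Bad2 j \<subseteq> C 0" by (auto simp: Bad2_def)
      ultimately have "\<exists>u\<in>Bad2 j. \<epsilon> * card (C j) \<le> card (nb \<kappa> u \<inter> C j)"
        using rich [THEN spec, of "Bad2 j", THEN spec, of "C j"] \<tau>(2) by simp
      then show False by (auto simp: Bad2_def)
    qed
    then have "card (Bad2 j) * (4 * real n) \<le> \<tau> * (4 * real n)" by (intro mult_right_mono) auto
    then show ?thesis using \<tau>(1) by (simp add: mult_ac)
  qed
  \<comment> \<open>Double counting of the pairs \<open>w\<close>, \<open>v\<close>: a fixed
    \<open>v\<close> is a violator only for those \<open>w\<close> whose degree into
    \<open>D\<close>, the wrong-colour neighbours of \<open>v\<close> in \<open>C j\<close>, is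
    irregular, and these are few.\<close>
  have b3: "card (Bad3 i j) * B \<le> 2 ^ 22 * real n ^ 6 * real (card V)" if ij: "j < r" "i < j" "i < st j" for i j
  proof -
    let ?P = "\<lambda>w v. (1/2 + \<eta>) * \<delta> * card (C j) < card {x \<in> nb (\<not> \<kappa>) v \<inter> C j. e w x \<longleftrightarrow> s j}"
    have "card {w \<in> V. \<epsilon> / (4 * real n) * card (C i) < card {v \<in> C i. ?P w v}} * (\<epsilon> / (4 * real n) * card (C i))
      \<le> card (C i) * (2 ^ 13 * real n ^ 3 * real (card V) / B)"
    proof (rule card_exceed_times_le)
      show "finite (C i)" "finite V" using C(1) [of i] ij finite_V finite_subset by auto
      show "0 \<le> \<epsilon> / (4 * real n) * card (C i)" using pos by simp
      fix v assume v: "v \<in> C i"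
      define D where "D = nb (\<not> \<kappa>) v \<inter> C j"
      have DC: "D \<subseteq> C j" "D \<subseteq> V" using C(1) [OF ij(1)] by (auto simp: D_def)
      have finD: "finite D" using DC finite_V finite_subset by blast
      have cD: "card D \<le> \<delta> * card (C j)" using cross [OF ij v] by (simp add: D_def)
      have sub: "{w \<in> V. ?P w v} \<subseteq> dev D"
      proof
        fix w assume w: "w \<in> {w \<in> V. ?P w v}"
        have "{x \<in> D. \<not> e w x} = D - {x \<in> D. e w x}" by auto
        then have c: "real (card {x \<in> D. \<not> e w x}) = card D - real (card {x \<in> D. e w x})"
          using finD by (simp add: card_Diff_subset of_nat_diff card_mono)
        have "(1/2 + \<eta>) * card D \<le> (1/2 + \<eta>) * (\<delta> * card (C j))"
          using cD pos by (intro mult_left_mono) auto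
        then have "(1/2 + \<eta>) * card D < card {x \<in> D. e w x \<longleftrightarrow> s j}"
          using w by (simp add: D_def mult.assoc)
        then show "w \<in> dev D"
          using w c by (cases "s j") (auto simp: dev_def algebra_simps)
      qed
      show "card {w \<in> V. ?P w v} \<le> 2 ^ 13 * real n ^ 3 * real (card V) / B"
      proof (cases "{w \<in> V. ?P w v} = {}")
        case True
        show ?thesis unfolding True using B by simp
      next
        \<comment> \<open>If some \<open>w\<close> exceeds the threshold, then so does
          \<open>card D\<close>, which is therefore at least \<open>B / (128 * n)\<close>; this
          makes the deviation bound for \<open>D\<close> effective.\<close>
        case False
        have "1/2 * (1 / (64 * real n)) * B \<le> (1/2 + \<eta>) * \<delta> * card (C j)"
          using pos \<delta> C(2) [OF ij(1)] B by (intro mult_mono) auto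
        also from False obtain w where "(1/2 + \<eta>) * \<delta> * card (C j) < card {x \<in> D. e w x \<longleftrightarrow> s j}"
          by (auto simp: D_def)
        also have "\<dots> \<le> card D" using finD by (simp add: card_mono)
        finally have dB: "B \<le> 128 * real n * real (card D)" using n0 by (simp add: field_simps)
        have "card {w \<in> V. ?P w v} * B \<le> real (card (dev D)) * (128 * real n * real (card D))"
          using sub dB B finite_V by (intro mult_mono) (auto intro!: card_mono simp: dev_def)
        also have "\<dots> = 128 * real n * (card (dev D) * real (card D))" by simp
        also have "\<dots> \<le> 128 * real n * (64 * (real n)\<^sup>2 * real (card V))"
          using dev [OF DC(2)] by (intro mult_left_mono) auto
        finally show ?thesis using B by (simp add: field_simps power2_eq_square power3_eq_cube)
      qed
    qed
    moreover have "{v \<in> C i. ?P w v} = violators \<kappa> ((1/2 + \<eta>) * \<delta>) C (s j) i j w" for w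
      by (simp add: violators_def)
    ultimately have "card (Bad3 i j) * (\<epsilon> / (4 * real n) * card (C i)) \<le> card (C i) * (2 ^ 13 * real n ^ 3 * real (card V) / B)"
      by (simp add: Bad3_def)
    moreover have "0 < real (card (C i))" using C(2) [of i] B ij by linarith
    ultimately have "card (Bad3 i j) * (\<epsilon> / (4 * real n)) \<le> 2 ^ 13 * real n ^ 3 * real (card V) / B"
      by (smt (verit) mult.assoc mult.commute mult_le_cancel_left_pos)
    then show ?thesis using B n0 by (simp add: \<epsilon> field_simps eval_nat_numeral)
  qed
  define S where "S = (\<Union>j\<in>{1..<r}. dev (C j)) \<union> (\<Union>j\<in>{j\<in>{1..<r}. st j = 0}. Bad2 j)
     \<union> (\<Union>p\<in>{(i, j). j < r \<and> i < j \<and> i < st j}. Bad3 (fst p) (snd p))"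
  let ?Q = "{(i, j). j < r \<and> i < j \<and> i < st j}"
  have Q: "?Q \<subseteq> {..<n} \<times> {..<n}" using r by auto
  have finQ: "finite ?Q" by (rule finite_subset [OF Q]) auto
  have cQ: "card ?Q \<le> n * n" using card_mono [OF _ Q] by simp
  have "card S \<le> (\<Sum>j\<in>{1..<r}. card (dev (C j))) + (\<Sum>j\<in>{j\<in>{1..<r}. st j = 0}. card (Bad2 j))
     + (\<Sum>p\<in>?Q. card (Bad3 (fst p) (snd p)))"
    unfolding S_def using finQ by (intro order_trans [OF card_Un_le] add_mono card_UN_le) auto
  then have "real (card S) \<le> (\<Sum>j\<in>{1..<r}. real (card (dev (C j)))) + (\<Sum>j\<in>{j\<in>{1..<r}. st j = 0}. real (card (Bad2 j)))
     + (\<Sum>p\<in>?Q. real (card (Bad3 (fst p) (snd p))))"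
    by (simp flip: of_nat_sum of_nat_add)
  also have "(\<Sum>j\<in>{1..<r}. real (card (dev (C j)))) \<le> (\<Sum>j\<in>{1..<r}. 64 * (real n)\<^sup>2 * real (card V) / B)"
    using b1 B by (intro sum_mono) (simp add: field_simps)
  also have "(\<Sum>j\<in>{1..<r}. 64 * (real n)\<^sup>2 * real (card V) / B) \<le> real n * (64 * (real n)\<^sup>2 * real (card V) / B)"
    unfolding sum_constant using r B by (intro mult_right_mono) auto
  also have "real n * (64 * (real n)\<^sup>2 * real (card V) / B) \<le> B / 4"
  proof -
    have "real n ^ 3 \<le> real n ^ 8" using n by (intro power_increasing) auto
    then have "64 * real n ^ 3 * card V \<le> 2 ^ 22 * real n ^ 8 * card V"
      by (intro mult_right_mono mult_mono) auto
    then show ?thesis using B by (simp add: field_simps power2_eq_square power3_eq_cube)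
  qed
  also have "(\<Sum>j\<in>{j\<in>{1..<r}. st j = 0}. real (card (Bad2 j))) \<le> (\<Sum>j\<in>{j\<in>{1..<r}. st j = 0}. b / (4 * n))"
    using b2 n0 by (intro sum_mono) (auto simp: field_simps)
  also have "\<dots> \<le> real n * (b / (4 * n))"
  proof -
    have "card {j\<in>{1..<r}. st j = 0} \<le> card {1..<r}" by (intro card_mono) auto
    then show ?thesis unfolding sum_constant using r b B by (intro mult_right_mono) auto
  qed
  also have "\<dots> = b / 4" using n0 by simp
  \<comment> \<open>At most \<open>n * n\<close> pairs give
    \<open>2 ^ 22 * n ^ 8 * card V / B\<close>; the constant \<open>2 ^ 24\<close> in the hypothesis
    on \<open>B\<close> turns this into \<open>B / 4\<close>.\<close>
  also have "(\<Sum>p\<in>?Q. real (card (Bad3 (fst p) (snd p)))) \<le> (\<Sum>p\<in>?Q. 2 ^ 22 * real n ^ 6 * real (card V) / B)"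
    using b3 B by (intro sum_mono) (auto simp: field_simps)
  also have "\<dots> \<le> real (n * n) * (2 ^ 22 * real n ^ 6 * real (card V) / B)"
    unfolding sum_constant using cQ B by (intro mult_right_mono) (auto simp del: of_nat_mult)
  also have "\<dots> \<le> B / 4"
    using B by (simp add: field_simps eval_nat_numeral)
  finally have "real (card S) < card (C 0)" using b B by linarith
  moreover have "finite S"
  proof (rule finite_subset [OF _ finite_V])
    show "S \<subseteq> V" using C(1) [OF r(1)] by (auto simp: S_def dev_def Bad2_def Bad3_def)
  qed
  ultimately have "\<not> C 0 \<subseteq> S" using card_mono [of S "C 0"] by force
  then obtain w where w: "w \<in> C 0" "w \<notin> S" by blast
  have wV: "w \<in> V" using w C(1) [of 0] r by auto
  show ?thesis
  proof (rule that [OF w(1)])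
    show "\<bar>real (card {x \<in> C j. e w x}) - card (C j) / 2\<bar> \<le> \<eta> * card (C j)" if "0 < j" "j < r" for j
    proof -
      have "w \<notin> dev (C j)" using w that by (auto simp: S_def)
      then show ?thesis using wV by (auto simp: dev_def)
    qed
    show "\<epsilon> * card (C j) \<le> card (nb \<kappa> w \<inter> C j)" if "0 < j" "j < r" "st j = 0" for j
    proof -
      have "w \<notin> Bad2 j" using w that by (auto simp: S_def)
      then show ?thesis using w by (auto simp: Bad2_def)
    qed
    show "card (violators \<kappa> ((1/2 + \<eta>) * \<delta>) C (s j) i j w) \<le> \<epsilon> / (4 * real n) * card (C i)"
      if "j < r" "i < j" "i < st j" for i j
    proof -
      have "w \<notin> Bad3 i j" using w that by (force simp: S_def)
      then show ?thesis using wV by (auto simp: Bad3_def)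
    qed
  qed
qed

text \<open>
  Embedding one vertex costs a pending candidate set a factor \<open>4\<close>, or \<open>2 / \<epsilon>\<close> inside its own block,
  and lets the wrong-colour density \<open>\<delta>\<close> grow by \<open>1 + 1 / n\<close>. The hypothesis on \<open>card (C j)\<close> is the budget
  for the \<open>j\<close> vertices embedded before position \<open>j\<close>.
\<close>

lemma embed_candidates:
  fixes n r :: nat and B \<delta> \<epsilon> \<eta> :: real and b :: "nat \<Rightarrow> real"
  assumes n: "2 \<le> n" and \<epsilon>: "\<epsilon> = 1 / (128 * (real n)\<^sup>2)" and \<eta>: "\<eta> = 1 / (16 * real n)"
    and deviation: "\<And>D. D \<subseteq> V \<Longrightarrow>
      card {w \<in> V. \<eta> * card D < \<bar>real (card {x \<in> D. e w x}) - card D / 2\<bar>} * (4 * \<eta>\<^sup>2 * card D) \<le> card V"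
    and B: "512 * (real n)\<^sup>2 \<le> B" "2 ^ 24 * real n ^ 8 * real (card V) \<le> B\<^sup>2"
  shows "r \<le> n \<Longrightarrow>
    (\<And>j. j < r \<Longrightarrow> C j \<subseteq> V \<and> B \<le> b j \<and> b j * 4 ^ j * (2 / \<epsilon>) ^ (j - st j) \<le> card (C j)) \<Longrightarrow>
    (\<And>i j v. j < r \<Longrightarrow> i < j \<Longrightarrow> i < st j \<Longrightarrow> v \<in> C i \<Longrightarrow> card (nb (\<not> \<kappa>) v \<inter> C j) \<le> \<delta> * card (C j)) \<Longrightarrow>
    (\<And>i j. j < r \<Longrightarrow> i < j \<Longrightarrow> st j \<le> i \<Longrightarrow> \<exists>\<tau>::real. 4 * real n * \<tau> \<le> b i \<and> \<tau> \<le> b j \<and>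
      (\<forall>U W. U \<subseteq> C i \<and> W \<subseteq> C j \<and> \<tau> \<le> card U \<and> \<tau> \<le> card W \<longrightarrow> (\<exists>u\<in>U. \<epsilon> * card W \<le> card (nb \<kappa> u \<inter> W)))) \<Longrightarrow>
    1 / (64 * real n) \<le> \<delta> \<Longrightarrow> \<delta> * (1 + 1 / real n) ^ r \<le> 1 / (16 * real n) \<Longrightarrow>
    \<exists>\<phi>. \<forall>j<r. \<phi> j \<in> C j \<and>
      (\<forall>i<j. \<phi> i \<noteq> \<phi> j \<and> (e (\<phi> i) (\<phi> j) \<longleftrightarrow> E i j) \<and> (E i j \<longrightarrow> (red (\<phi> i) (\<phi> j) \<longleftrightarrow> \<kappa>)))"
proof (induction r arbitrary: C st b \<delta> E)
  case 0
  then show ?case by simp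
next
  case (Suc r)
  note C = Suc.prems(2) and cross = Suc.prems(3) and same = Suc.prems(4)
  have n2: "2 \<le> real n" using n by simp
  have \<epsilon>0: "0 < \<epsilon>" using n2 \<epsilon> by simp
  have \<epsilon>1: "\<epsilon> \<le> 1 / (256 * real n)" "\<epsilon> \<le> 1 / 512"
  proof -
    have "2 * real n \<le> real n * real n" "4 \<le> real n * real n"
      using n2 mult_mono [OF n2 n2] by (auto intro: mult_right_mono)
    then show "\<epsilon> \<le> 1 / (256 * real n)" "\<epsilon> \<le> 1 / 512"
      using n2 by (auto simp: \<epsilon> field_simps power2_eq_square)
  qed
  have pw: "1 \<le> 4 ^ j * (2 / \<epsilon>) ^ k" for j k
    using \<epsilon>0 \<epsilon>1 mult_mono [of 1 "4 ^ j" 1 "(2 / \<epsilon>) ^ k"] one_le_power [of "2 / \<epsilon>" k] by simp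
  have B0: "0 < B" using B(1) n2 by (meson less_le_trans mult_pos_pos zero_less_power zero_less_numeral)
  have bC: "b j \<le> card (C j)" if "j < Suc r" for j
  proof -
    have "b j * 1 \<le> b j * (4 ^ j * (2 / \<epsilon>) ^ (j - st j))"
      using C [OF that] B0 pw by (intro mult_left_mono) auto
    then show ?thesis using C [OF that] by (simp add: mult.assoc)
  qed
  have BC: "B \<le> card (C j)" if "j < Suc r" for j using bC [OF that] C [OF that] by linarith
  have g1: "1 \<le> (1 + 1 / real n) ^ r" "1 \<le> (1 + 1 / real n) ^ Suc r" by (rule one_le_power, simp)+
  have \<delta>0: "0 < \<delta>" using Suc.prems(5) n2 by (meson less_le_trans divide_pos_pos mult_pos_pos zero_less_numeral zero_less_one)
  have \<delta>1: "\<delta> \<le> 1 / (16 * real n)"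
    using mult_left_mono [OF g1(2), of \<delta>] \<delta>0 Suc.prems(6) by linarith
  have same0: "\<exists>\<tau>::real. 4 * real n * \<tau> \<le> b 0 \<and> \<tau> \<le> card (C j) \<and>
      (\<forall>U W. U \<subseteq> C 0 \<and> W \<subseteq> C j \<and> \<tau> \<le> card U \<and> \<tau> \<le> card W \<longrightarrow> (\<exists>u\<in>U. \<epsilon> * card W \<le> card (nb \<kappa> u \<inter> W)))"
    if "0 < j" "j < Suc r" "st j = 0" for j
    using same [of j 0] that bC [of j] by (auto intro: order_trans)
  obtain w where w: "w \<in> C 0"
    and dev: "\<And>j. 0 < j \<Longrightarrow> j < Suc r \<Longrightarrow> \<bar>real (card {x \<in> C j. e w x}) - card (C j) / 2\<bar> \<le> \<eta> * card (C j)"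
    and rich: "\<And>j. 0 < j \<Longrightarrow> j < Suc r \<Longrightarrow> st j = 0 \<Longrightarrow> \<epsilon> * card (C j) \<le> card (nb \<kappa> w \<inter> C j)"
    and viol: "\<And>i j. j < Suc r \<Longrightarrow> i < j \<Longrightarrow> i < st j \<Longrightarrow>
      card (violators \<kappa> ((1/2 + \<eta>) * \<delta>) C (E 0 j) i j w) \<le> \<epsilon> / (4 * real n) * card (C i)"
    by (rule ex_good_vertex [where r = "Suc r" and C = C and st = st and s = "E 0" and b = "b 0" and B = B,
          OF n _ Suc.prems(1) \<epsilon> \<eta> deviation B0 B(2) _ BC _ bC Suc.prems(5) cross same0])
      (use C in auto)
  \<comment> \<open>The candidates that would spoil the density condition towards a later block. At
    most \<open>n\<close> sets, each with an \<open>\<epsilon> / (4 * n)\<close> share of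
    \<open>C j\<close>, cost less than the \<open>\<epsilon>\<close> share guaranteed by
    \<open>rich\<close>.\<close>
  define Del where "Del j = (\<Union>k\<in>{k. k < Suc r \<and> j < k \<and> j < st k}. violators \<kappa> ((1/2 + \<eta>) * \<delta>) C (E 0 k) j k w)" for j
  define C1 where "C1 j = {x \<in> C j. x \<noteq> w \<and> (e w x \<longleftrightarrow> E 0 j) \<and> (E 0 j \<longrightarrow> (red w x \<longleftrightarrow> \<kappa>))} - Del j" for j
  have finC: "finite (C j)" if "j < Suc r" for j using C [OF that] finite_V finite_subset by blast
  have Del: "card (Del j) \<le> \<epsilon> / 4 * card (C j)" if "j < Suc r" for j
  proof -
    let ?K = "{k. k < Suc r \<and> j < k \<and> j < st k}"
    have "?K \<subseteq> {..<Suc r}" by auto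
    then have K: "card ?K \<le> n" using card_mono [of "{..<Suc r}" ?K] Suc.prems(1) by simp
    have "card (Del j) \<le> (\<Sum>k\<in>?K. card (violators \<kappa> ((1/2 + \<eta>) * \<delta>) C (E 0 k) j k w))"
      unfolding Del_def by (rule card_UN_le) auto
    then have "real (card (Del j)) \<le> (\<Sum>k\<in>?K. real (card (violators \<kappa> ((1/2 + \<eta>) * \<delta>) C (E 0 k) j k w)))"
      by (simp flip: of_nat_sum)
    also have "\<dots> \<le> (\<Sum>k\<in>?K. \<epsilon> / (4 * real n) * card (C j))" by (rule sum_mono) (use viol in auto)
    also have "\<dots> \<le> real n * (\<epsilon> / (4 * real n) * card (C j))"
      unfolding sum_constant using K \<epsilon>0 by (intro mult_right_mono) auto
    finally show ?thesis using n2 by simp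
  qed
  \<comment> \<open>Absorbs the removal of the point \<open>w\<close> itself into a further share
    \<open>\<epsilon> / 4\<close>.\<close>
  have large: "1 \<le> \<epsilon> / 4 * card (C j)" if "j < Suc r" for j
  proof -
    have "512 * (real n)\<^sup>2 \<le> card (C j)" using B(1) BC [OF that] by linarith
    then show ?thesis using n2 by (simp add: \<epsilon> field_simps)
  qed
  have finDel: "finite (Del j)" if "j < Suc r" for j
    by (rule finite_subset [OF _ finC [OF that]]) (auto simp: Del_def violators_def)
  have sizeN: "(1/2 - \<eta> - \<epsilon> / 2) * card (C j) \<le> card (C1 j)" if "\<not> E 0 j" "0 < j" "j < Suc r" for j
  proof -
    have "C1 j = C j - {x \<in> C j. e w x} - {w} - Del j" using that by (auto simp: C1_def)
    moreover have "real (card (C j)) - card {x \<in> C j. e w x} - 1 - card (Del j) \<le> card (C j - {x \<in> C j. e w x} - {w} - Del j)"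
    proof -
      have "card (C j) \<le> card (C j - {x \<in> C j. e w x} - {w} - Del j) + card {x \<in> C j. e w x} + card {w} + card (Del j)"
        using diff_card_le_card_Diff [of "{x \<in> C j. e w x}" "C j"]
          diff_card_le_card_Diff [of "{w}" "C j - {x \<in> C j. e w x}"]
          diff_card_le_card_Diff [of "Del j" "C j - {x \<in> C j. e w x} - {w}"]
          finC [OF that(3)] finDel [OF that(3)] by auto
      then show ?thesis by simp
    qed
    ultimately show ?thesis using dev [OF that(2,3)] Del [OF that(3)] large [OF that(3)]
      by (simp add: algebra_simps abs_le_iff)
  qed
  \<comment> \<open>Here \<open>j\<close> lies in a later block, so the wrong-coloured neighbours of
    \<open>w\<close> form at most a \<open>\<delta>\<close> share of \<open>C j\<close>.\<close>
  have sizeC: "(1/2 - \<eta> - \<delta> - \<epsilon> / 2) * card (C j) \<le> card (C1 j)" if "E 0 j" "0 < st j" "0 < j" "j < Suc r" for j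
  proof -
    let ?G = "{x \<in> C j. e w x}" and ?N = "nb (\<not> \<kappa>) w \<inter> C j"
    have "?G - ?N - {w} - Del j \<subseteq> C1 j"
      using that C [OF that(4)] by (auto simp: C1_def nb_def)
    then have "card (?G - ?N - {w} - Del j) \<le> card (C1 j)"
      using finC [OF that(4)] by (intro card_mono) (auto simp: C1_def)
    moreover have "card ?G \<le> card (?G - ?N - {w} - Del j) + card ?N + card {w} + card (Del j)"
      using diff_card_le_card_Diff [of ?N ?G] diff_card_le_card_Diff [of "{w}" "?G - ?N"]
        diff_card_le_card_Diff [of "Del j" "?G - ?N - {w}"]
        finC [OF that(4)] finDel [OF that(4)] by auto
    ultimately have "real (card ?G) \<le> card (C1 j) + real (card ?N) + 1 + card (Del j)" by simp
    moreover have "card ?N \<le> \<delta> * card (C j)" using cross [of j 0 w] that w by simp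
    ultimately show ?thesis using dev [OF that(3,4)] Del [OF that(4)] large [OF that(4)]
      by (simp add: algebra_simps abs_le_iff)
  qed
  \<comment> \<open>Inside the block of \<open>w\<close> nothing bounds the wrong colour; an edge
    has to rely on \<open>rich\<close>, which gives only a share of order
    \<open>\<epsilon>\<close>.\<close>
  have sizeS: "\<epsilon> / 2 * card (C j) \<le> card (C1 j)" if "st j = 0" "0 < j" "j < Suc r" for j
  proof (cases "E 0 j")
    case True
    have "(nb \<kappa> w \<inter> C j) - Del j \<subseteq> C1 j" using True by (auto simp: C1_def nb_def)
    then have "card ((nb \<kappa> w \<inter> C j) - Del j) \<le> card (C1 j)"
      using finC [OF that(3)] by (intro card_mono) (auto simp: C1_def)
    moreover have "card (nb \<kappa> w \<inter> C j) - card (Del j) \<le> card ((nb \<kappa> w \<inter> C j) - Del j)"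
      by (rule diff_card_le_card_Diff [OF finDel [OF that(3)]])
    ultimately have "real (card (nb \<kappa> w \<inter> C j)) \<le> card (C1 j) + real (card (Del j))" by simp
    then show ?thesis using rich [OF that(2,3,1)] Del [OF that(3)] \<epsilon>0 large [OF that(3)] by (simp add: algebra_simps)
  next
    case False
    have "\<epsilon> / 2 \<le> 1/2 - \<eta> - \<epsilon> / 2" using \<epsilon>1 n2 by (simp add: \<eta> field_simps)
    then show ?thesis using sizeN [OF False that(2,3)]
      by (meson mult_right_mono of_nat_0_le_iff order_trans)
  qed
  \<comment> \<open>\<open>1/7\<close> exceeds \<open>1/16 + 1/16 + 1/512\<close>, the losses to
    \<open>\<eta>\<close>, \<open>\<delta>\<close> and \<open>\<epsilon> / 2\<close>, yet is small
    enough for the growth of \<open>\<delta>\<close> to stay within \<open>1 + 1 / n\<close>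
    below.\<close>
  have sizeX: "(1/2 - 1 / (7 * real n)) * card (C j) \<le> card (C1 j)" if "0 < st j" "0 < j" "j < Suc r" for j
  proof -
    have *: "\<epsilon> / 2 \<le> (1 / 512) * (1 / real n)" "\<delta> \<le> (1 / 16) * (1 / real n)" "\<eta> = (1/16) * (1 / real n)"
      "1 / (7 * real n) = (1/7) * (1 / real n)" "0 < 1 / real n"
      using \<epsilon>1 \<delta>1 n2 by (simp_all add: \<eta>)
    have "1/2 - 1 / (7 * real n) \<le> 1/2 - \<eta> - \<delta> - \<epsilon> / 2" "1/2 - 1 / (7 * real n) \<le> 1/2 - \<eta> - \<epsilon> / 2"
      using * \<delta>0 by linarith+
    then show ?thesis using sizeN [OF _ that(2,3)] sizeC [OF _ that]
      by (cases "E 0 j") (meson mult_right_mono of_nat_0_le_iff order_trans)+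
  qed
  have "\<exists>\<phi>. \<forall>j<r. \<phi> j \<in> C1 (Suc j) \<and> (\<forall>i<j. \<phi> i \<noteq> \<phi> j \<and> (e (\<phi> i) (\<phi> j) \<longleftrightarrow> E (Suc i) (Suc j)) \<and>
     (E (Suc i) (Suc j) \<longrightarrow> (red (\<phi> i) (\<phi> j) \<longleftrightarrow> \<kappa>)))"
  \<comment> \<open>Position \<open>0\<close> is used up and all others move down by one. Truncated
    subtraction keeps at \<open>0\<close> the start of the block that contained
    \<open>w\<close>.\<close>
  proof (rule Suc.IH [where C = "\<lambda>j. C1 (Suc j)" and st = "\<lambda>j. st (Suc j) - 1" and b = "\<lambda>j. b (Suc j)" and
       \<delta> = "\<delta> * (1 + 1 / real n)" and E = "\<lambda>i j. E (Suc i) (Suc j)"])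
    show "r \<le> n" using Suc.prems(1) by simp
    fix j assume j: "j < r"
    have CS: "C (Suc j) \<subseteq> V" "B \<le> b (Suc j)"
      "b (Suc j) * 4 ^ Suc j * (2 / \<epsilon>) ^ (Suc j - st (Suc j)) \<le> card (C (Suc j))" using C [of "Suc j"] j by auto
    have b0: "0 \<le> b (Suc j) * 4 ^ j * (2 / \<epsilon>) ^ k" for k using CS(2) B0 \<epsilon>0 by simp
    have "b (Suc j) * 4 ^ j * (2 / \<epsilon>) ^ (j - (st (Suc j) - 1)) \<le> card (C1 (Suc j))"
    proof (cases "st (Suc j) = 0")
      case True
      have "b (Suc j) * 4 ^ j * (2 / \<epsilon>) ^ j * 4 = \<epsilon> / 2 * (b (Suc j) * 4 ^ Suc j * (2 / \<epsilon>) ^ (Suc j))"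
        using \<epsilon>0 by simp
      also have "\<dots> \<le> \<epsilon> / 2 * card (C (Suc j))" using CS(3) \<epsilon>0 True by (intro mult_left_mono) auto
      also have "\<dots> \<le> card (C1 (Suc j))" using sizeS [OF True] j by simp
      finally show ?thesis using b0 [of j] True by simp
    next
      case False
      then have "j - (st (Suc j) - 1) = Suc j - st (Suc j)" by simp
      then have "b (Suc j) * 4 ^ j * (2 / \<epsilon>) ^ (j - (st (Suc j) - 1)) \<le> 1/4 * card (C (Suc j))"
        using CS(3) by simp
      also have "\<dots> \<le> (1/2 - 1 / (7 * real n)) * card (C (Suc j))"
        using n2 by (intro mult_right_mono) (auto simp: field_simps)
      also have "\<dots> \<le> card (C1 (Suc j))" using sizeX [of "Suc j"] False j by simp
      finally show ?thesis .
    qed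
    then show "C1 (Suc j) \<subseteq> V \<and> B \<le> b (Suc j) \<and>
       b (Suc j) * 4 ^ j * (2 / \<epsilon>) ^ (j - (st (Suc j) - 1)) \<le> card (C1 (Suc j))"
      using CS by (auto simp: C1_def)
    fix i assume i: "i < j"
    show "card (nb (\<not> \<kappa>) v \<inter> C1 (Suc j)) \<le> \<delta> * (1 + 1 / real n) * card (C1 (Suc j))"
      if st: "i < st (Suc j) - 1" and v: "v \<in> C1 (Suc i)" for v
    proof -
      \<comment> \<open>Since \<open>v\<close> survived the deletion, its wrong-colour neighbourhood
        shrinks by nearly the same factor \<open>1/2\<close> as \<open>C (Suc j)\<close> does, so
        the density hardly grows.\<close>
      have "v \<notin> violators \<kappa> ((1/2 + \<eta>) * \<delta>) C (E 0 (Suc j)) (Suc i) (Suc j) w" "v \<in> C (Suc i)"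
        using v st i j by (auto simp: C1_def Del_def)
      then have *: "card {x \<in> nb (\<not> \<kappa>) v \<inter> C (Suc j). e w x \<longleftrightarrow> E 0 (Suc j)} \<le> (1/2 + \<eta>) * \<delta> * card (C (Suc j))"
        by (auto simp: violators_def)
      have "card (nb (\<not> \<kappa>) v \<inter> C1 (Suc j)) \<le> card {x \<in> nb (\<not> \<kappa>) v \<inter> C (Suc j). e w x \<longleftrightarrow> E 0 (Suc j)}"
        using finC [of "Suc j"] j by (intro card_mono) (auto simp: C1_def)
      then have "card (nb (\<not> \<kappa>) v \<inter> C1 (Suc j)) \<le> \<delta> * ((1/2 + \<eta>) * card (C (Suc j)))" using * by (simp add: mult_ac)
      also have "\<dots> \<le> \<delta> * ((1 + 1 / real n) * (1/2 - 1 / (7 * real n)) * card (C (Suc j)))"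
      proof (intro mult_left_mono mult_right_mono)
        define x where "x = 1 / real n"
        have x: "0 \<le> x" "x \<le> 1/2" using n2 by (auto simp: x_def field_simps)
        then have "x * x \<le> 1/2 * x" by (intro mult_right_mono)
        moreover have "(1 + x) * (1/2 - 1/7 * x) = 1/2 + 5/14 * x - 1/7 * (x * x)" by (simp add: field_simps)
        ultimately have "1/2 + 1/16 * x \<le> (1 + x) * (1/2 - 1/7 * x)" using x by linarith
        then show "1/2 + \<eta> \<le> (1 + 1 / real n) * (1/2 - 1 / (7 * real n))" by (simp add: \<eta> x_def)
      qed (use \<delta>0 in auto)
      also have "\<dots> = \<delta> * (1 + 1 / real n) * ((1/2 - 1 / (7 * real n)) * card (C (Suc j)))" by simp
      also have "\<dots> \<le> \<delta> * (1 + 1 / real n) * card (C1 (Suc j))"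
        using sizeX [of "Suc j"] st j \<delta>0 by (intro mult_left_mono) auto
      finally show ?thesis .
    qed
    show "\<exists>\<tau>::real. 4 * real n * \<tau> \<le> b (Suc i) \<and> \<tau> \<le> b (Suc j) \<and>
      (\<forall>U W. U \<subseteq> C1 (Suc i) \<and> W \<subseteq> C1 (Suc j) \<and> \<tau> \<le> card U \<and> \<tau> \<le> card W \<longrightarrow>
         (\<exists>u\<in>U. \<epsilon> * card W \<le> card (nb \<kappa> u \<inter> W)))"
      if st: "st (Suc j) - 1 \<le> i"
    proof -
      have "C1 (Suc i) \<subseteq> C (Suc i)" "C1 (Suc j) \<subseteq> C (Suc j)" by (auto simp: C1_def)
      moreover have "\<exists>\<tau>::real. 4 * real n * \<tau> \<le> b (Suc i) \<and> \<tau> \<le> b (Suc j) \<and>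
        (\<forall>U W. U \<subseteq> C (Suc i) \<and> W \<subseteq> C (Suc j) \<and> \<tau> \<le> card U \<and> \<tau> \<le> card W \<longrightarrow>
         (\<exists>u\<in>U. \<epsilon> * card W \<le> card (nb \<kappa> u \<inter> W)))"
        using same [of "Suc j" "Suc i"] i j st by simp
      ultimately show ?thesis by (meson subset_trans)
    qed
  next
    have "\<delta> \<le> \<delta> * (1 + 1 / real n)" using \<delta>0 by (simp add: algebra_simps)
    then show "1 / (64 * real n) \<le> \<delta> * (1 + 1 / real n)" using Suc.prems(5) by linarith
    show "\<delta> * (1 + 1 / real n) * (1 + 1 / real n) ^ r \<le> 1 / (16 * real n)" using Suc.prems(6) by (simp add: mult.assoc)
  qed
  then obtain \<phi> where \<phi>: "\<And>j. j < r \<Longrightarrow> \<phi> j \<in> C1 (Suc j)"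
    and \<phi>2: "\<And>i j. j < r \<Longrightarrow> i < j \<Longrightarrow> \<phi> i \<noteq> \<phi> j \<and> (e (\<phi> i) (\<phi> j) \<longleftrightarrow> E (Suc i) (Suc j)) \<and>
     (E (Suc i) (Suc j) \<longrightarrow> (red (\<phi> i) (\<phi> j) \<longleftrightarrow> \<kappa>))" by blast
  define \<psi> where "\<psi> j = (case j of 0 \<Rightarrow> w | Suc k \<Rightarrow> \<phi> k)" for j
  have "\<psi> j \<in> C j \<and> (\<forall>i<j. \<psi> i \<noteq> \<psi> j \<and> (e (\<psi> i) (\<psi> j) \<longleftrightarrow> E i j) \<and> (E i j \<longrightarrow> (red (\<psi> i) (\<psi> j) \<longleftrightarrow> \<kappa>)))"
    if "j < Suc r" for j
  proof (cases j)
    case 0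
    then show ?thesis using w by (simp add: \<psi>_def)
  next
    case (Suc k)
    have k: "\<phi> k \<in> C1 (Suc k)" using \<phi> that Suc by simp
    have "\<psi> i \<noteq> \<psi> j \<and> (e (\<psi> i) (\<psi> j) \<longleftrightarrow> E i j) \<and> (E i j \<longrightarrow> (red (\<psi> i) (\<psi> j) \<longleftrightarrow> \<kappa>))" if "i < j" for i
      using k \<phi>2 [of k "i - 1"] \<open>j < Suc r\<close> that Suc by (cases i) (auto simp: \<psi>_def C1_def)
    then show ?thesis using k Suc by (auto simp: \<psi>_def C1_def)
  qed
  then show ?case by blast
qed

end

section \<open>Parameters for the inner product graph\<close>

text \<open>The dimension must leave parts of size \<open>B\<close> after all losses, and
  \<open>B\<^sup>2\<close> must still beat \<open>n ^ 8 * 2 ^ d\<close>. With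
  \<open>n = 2 ^ h\<close>, the exponents \<open>200 * h * n\<close> for the graph and
  \<open>134 * h * n\<close> for \<open>B\<close> achieve both.\<close>

lemma induced_ramsey_parity_graph:
  fixes h :: nat and red :: "nat set \<Rightarrow> nat set \<Rightarrow> bool" and E :: "nat \<Rightarrow> nat \<Rightarrow> bool"
  assumes h: "0 < h" and sym: "\<And>x y. red x y \<longleftrightarrow> red y x"
    and E_sym: "\<And>i j. E i j \<longleftrightarrow> E j i"
  shows "\<exists>\<phi> \<kappa>. inj_on \<phi> {..<2 ^ h} \<and> \<phi> ` {..<2 ^ h} \<subseteq> Pow {..<200 * h * 2 ^ h} \<and>
    (\<forall>i<2 ^ h. \<forall>j<2 ^ h. i \<noteq> j \<longrightarrow>
       (odd (card (\<phi> i \<inter> \<phi> j)) \<longleftrightarrow> E i j) \<and> (E i j \<longrightarrow> (red (\<phi> i) (\<phi> j) \<longleftrightarrow> \<kappa>)))"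
proof -
  define n :: nat where "n = 2 ^ h"
  define d where "d = 200 * h * n"
  define V where "V = Pow {..<d}"
  define e where "e x y = odd (card (x \<inter> y))" for x y :: "nat set"
  interpret edge_coloured_graph V e red
    by unfold_locales (auto simp: V_def e_def sym Int_commute)
  have n: "2 \<le> n" using h by (cases h) (auto simp: n_def)
  have n2: "2 \<le> real n" using n by simp
  have cV: "card V = 2 ^ d" by (simp add: V_def card_Pow)
  define \<epsilon> where "\<epsilon> = 1 / (128 * (real n)\<^sup>2)"
  define \<eta> where "\<eta> = 1 / (16 * real n)"
  define \<delta> where "\<delta> = 2 * n * \<epsilon>"
  \<comment> \<open>The reciprocal of the factor \<open>2 / \<epsilon>\<close> that an embedded
    vertex costs inside its block.\<close>
  define p where "p = \<epsilon> / 2"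
  \<comment> \<open>Small enough for \<open>4 * n * \<gamma> \<le> 1 / 4 ^ n\<close>, so that the
    density threshold stays below \<open>b j\<close> by a factor \<open>4 * n\<close>.\<close>
  define \<gamma> :: real where "\<gamma> = 1 / 64 ^ n"
  define \<theta> where "\<theta> k = \<gamma> * p ^ k" for k
  define B :: real where "B = 2 ^ (134 * h * n)"
  have \<epsilon>0: "0 < \<epsilon>" using n2 by (simp add: \<epsilon>_def)
  have pe: "p = 1 / 2 ^ (8 + 2 * h)"
    by (simp add: p_def \<epsilon>_def n_def power_add power_mult mult.commute)
  have p: "0 < p" "p \<le> 1" by (auto simp: pe)
  have \<gamma>: "0 < \<gamma>" "\<gamma> \<le> 1" by (auto simp: \<gamma>_def)
  have \<delta>: "\<delta> = 1 / (64 * real n)" using n2 by (simp add: \<delta>_def \<epsilon>_def power2_eq_square)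
  obtain \<kappa> Z st c where L: "layered \<epsilon> \<theta> \<delta> \<kappa> (2 ^ h)
      ((\<gamma> / 2) ^ (h + h) * p ^ (2 * (2 ^ h + 2 ^ h)) * card V) V Z st c"
    using ex_layered [OF \<epsilon>0 _ \<delta>_def p \<gamma> \<theta>_def, of h h V True] n by (auto simp: n_def)
  \<comment> \<open>What is left of \<open>Z j\<close> after at most \<open>n\<close> losses of a
    factor \<open>4\<close> and at most \<open>c j\<close> losses of a factor
    \<open>2 / \<epsilon>\<close>.\<close>
  define b where "b j = card (Z j) * (1 / 4 ^ n * p ^ c j)" for j
  have Z: "Z j \<subseteq> V" "(\<gamma> / 2) ^ (h + h) * p ^ (4 * n) * card V \<le> card (Z j)" "j \<le> st j + c j" "c j \<le> n"
    if "j < n" for j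
    using L that unfolding layered_def by (auto simp: n_def mult_2 [symmetric])
  have Bb: "B \<le> b j" if "j < n" for j
  proof -
    have hn: "h \<le> h * n" "n \<le> h * n" "h * 2 \<le> h * n" using h n by auto
    \<comment> \<open>The three terms are the binary exponents lost through
      \<open>(\<gamma> / 2) ^ (2 * h)\<close>, \<open>p ^ (5 * n)\<close> and
      \<open>1 / 4 ^ n\<close>; together they fit into \<open>66 * h * n\<close>, the gap between
      \<open>200\<close> and \<open>134\<close>.\<close>
    have "(6 * n + 1) * (2 * h) + (8 + 2 * h) * (5 * n) + 2 * n = 22 * (h * n) + 2 * h + 42 * n"
      by (simp add: algebra_simps)
    then have "134 * h * n + ((6 * n + 1) * (2 * h) + (8 + 2 * h) * (5 * n) + 2 * n) \<le> d"
      using hn unfolding d_def mult.assoc by linarith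
    then have "(2::real) ^ (134 * h * n + ((6 * n + 1) * (2 * h) + (8 + 2 * h) * (5 * n) + 2 * n)) \<le> 2 ^ d"
      by (rule power_increasing) simp
    then have le: "B * (2 ^ ((6 * n + 1) * (2 * h)) * 2 ^ ((8 + 2 * h) * (5 * n)) * 2 ^ (2 * n)) \<le> 2 ^ d"
      unfolding B_def power_add .
    have "\<gamma> / 2 = 1 / 2 ^ (6 * n + 1)" by (simp add: \<gamma>_def power_mult)
    then have eq: "(\<gamma> / 2) ^ (2 * h) = 1 / 2 ^ ((6 * n + 1) * (2 * h))" "p ^ (5 * n) = 1 / 2 ^ ((8 + 2 * h) * (5 * n))"
      "(1::real) / 4 ^ n = 1 / 2 ^ (2 * n)"
      unfolding pe by (simp_all only: power_one_over power_mult) simp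
    have "B \<le> 2 ^ d * ((\<gamma> / 2) ^ (2 * h) * p ^ (5 * n) * (1 / 4 ^ n))"
    proof -
      have "a \<le> x * (1 / u * (1 / v) * (1 / z))" if "a * (u * v * z) \<le> x" "0 < u" "0 < v" "0 < z" for a u v x z :: real
        using that by (simp add: field_simps)
      then show ?thesis unfolding eq using le by (meson zero_less_power zero_less_numeral)
    qed
    also have "\<dots> = ((\<gamma> / 2) ^ (h + h) * p ^ (4 * n) * card V) * (1 / 4 ^ n * p ^ n)"
      by (simp add: cV mult_2 [symmetric] power_add [symmetric] mult_ac)
    also have "\<dots> \<le> card (Z j) * (1 / 4 ^ n * p ^ c j)"
      using Z [OF that] p by (intro mult_mono power_decreasing) auto
    finally show ?thesis by (simp add: b_def)
  qed
  have "\<exists>\<phi>. \<forall>j<n. \<phi> j \<in> Z j \<and>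
      (\<forall>i<j. \<phi> i \<noteq> \<phi> j \<and> (e (\<phi> i) (\<phi> j) \<longleftrightarrow> E i j) \<and> (E i j \<longrightarrow> (red (\<phi> i) (\<phi> j) \<longleftrightarrow> \<kappa>)))"
  proof (rule embed_candidates [OF n \<epsilon>_def \<eta>_def, where B = B and b = b and st = st and \<delta> = \<delta>])
    show "card {w \<in> V. \<eta> * card D < \<bar>real (card {x \<in> D. e w x}) - card D / 2\<bar>} * (4 * \<eta>\<^sup>2 * card D) \<le> card V"
      if "D \<subseteq> V" for D
      using parity_graph_deviation [of D d \<eta>] that by (simp add: V_def e_def \<eta>_def card_Pow)
    show "512 * (real n)\<^sup>2 \<le> B"
    proof -
      have "h \<le> h * n" using n by simp
      then have "9 + h * 2 \<le> 134 * h * n" using h by linarith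
      then have "(2::real) ^ (9 + h * 2) \<le> 2 ^ (134 * h * n)" by (rule power_increasing) simp
      then show ?thesis by (simp add: B_def n_def power_add power_mult)
    qed
    show "2 ^ 24 * real n ^ 8 * real (card V) \<le> B\<^sup>2"
    proof -
      have "h \<le> h * n" using n by simp
      then have "24 + h * 8 + d \<le> (134 * h * n) * 2" using h unfolding d_def mult.assoc by linarith
      then have "(2::real) ^ (24 + h * 8 + d) \<le> 2 ^ ((134 * h * n) * 2)" by (rule power_increasing) simp
      then show ?thesis unfolding B_def cV n_def power_add power_mult by simp
    qed
    \<comment> \<open>All \<open>n\<close> steps together enlarge the initial
      \<open>1 / (64 * n)\<close> by less than \<open>exp 1\<close>, hence by less than
      \<open>4\<close>.\<close>
    show "\<delta> * (1 + 1 / real n) ^ n \<le> 1 / (16 * real n)"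
    proof -
      have "(1 + 1 / real n) ^ n \<le> exp (1 / real n) ^ n" by (intro power_mono) auto
      also have "\<dots> = exp 1" using n2 by (simp flip: exp_of_nat_mult)
      also have "\<dots> \<le> 4" using exp_le by simp
      finally have "\<delta> * (1 + 1 / real n) ^ n \<le> \<delta> * 4" using n2 by (intro mult_left_mono) (auto simp: \<delta>)
      then show ?thesis by (simp add: \<delta>)
    qed
    fix j assume j: "j < n"
    show "Z j \<subseteq> V \<and> B \<le> b j \<and> b j * 4 ^ j * (2 / \<epsilon>) ^ (j - st j) \<le> card (Z j)"
    proof (intro conjI Z(1) Bb j)
      have "b j * 4 ^ j * (2 / \<epsilon>) ^ (j - st j) = card (Z j) * ((4 ^ j / 4 ^ n) * (p ^ c j * (1 / p) ^ (j - st j)))"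
        by (simp add: b_def p_def)
      also have "\<dots> \<le> real (card (Z j)) * (1 * 1)"
      proof (intro mult_left_mono mult_mono)
        have "(4::real) ^ j \<le> 4 ^ n" using j by (intro power_increasing) auto
        then show "(4::real) ^ j / 4 ^ n \<le> 1" by simp
        have "p ^ c j \<le> p ^ (j - st j)" using p Z(3) [OF j] by (intro power_decreasing) auto
        then show "p ^ c j * (1 / p) ^ (j - st j) \<le> 1" using p by (simp add: power_one_over)
      qed (use p in auto)
      finally show "b j * 4 ^ j * (2 / \<epsilon>) ^ (j - st j) \<le> card (Z j)" by simp
    qed
    fix i assume i: "i < j"
    show "card (nb (\<not> \<kappa>) v \<inter> Z j) \<le> \<delta> * card (Z j)" if "i < st j" "v \<in> Z i" for v
      using L i j that unfolding layered_def by (auto simp: n_def)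
    show "\<exists>\<tau>::real. 4 * real n * \<tau> \<le> b i \<and> \<tau> \<le> b j \<and>
      (\<forall>U W. U \<subseteq> Z i \<and> W \<subseteq> Z j \<and> \<tau> \<le> card U \<and> \<tau> \<le> card W \<longrightarrow> (\<exists>u\<in>U. \<epsilon> * card W \<le> card (nb \<kappa> u \<inter> W)))"
      if "st j \<le> i"
    proof (intro exI conjI)
      have same: "Z i = Z j" "c i = c j" "hered_dense \<epsilon> (\<theta> (c j)) \<kappa> (Z j)"
        using L i j that unfolding layered_def by (auto simp: n_def)
      let ?\<tau> = "\<theta> (c j) * card (Z j)"
      have "n < 4 ^ n" by (rule less_exp [THEN less_le_trans]) (simp add: power_mono)
      then have "real n \<le> 4 ^ n" by (metis less_imp_le of_nat_le_iff of_nat_numeral of_nat_power)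
      moreover have "(4::real) \<le> 4 ^ n" using n power_increasing [of 1 n "4::real"] by simp
      ultimately have "4 * real n \<le> 4 ^ n * 4 ^ n" by (intro mult_mono) auto
      then have "4 * real n * \<gamma> \<le> 1 / 4 ^ n"
        using power_mult_distrib [of "16::real" 4 n] power_mult_distrib [of "4::real" 4 n] by (simp add: \<gamma>_def field_simps)
      then have "4 * real n * \<gamma> * (p ^ c j * card (Z j)) \<le> 1 / 4 ^ n * (p ^ c j * card (Z j))"
        using p by (intro mult_right_mono) auto
      then show 1: "4 * real n * ?\<tau> \<le> b i" by (simp add: same b_def \<theta>_def mult_ac)
      have "0 \<le> ?\<tau>" using p \<gamma> by (simp add: \<theta>_def)
      then have "1 * ?\<tau> \<le> 4 * real n * ?\<tau>" using n2 by (intro mult_right_mono) auto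
      then show "?\<tau> \<le> b j" using 1 by (simp add: same b_def)
      show "\<forall>U W. U \<subseteq> Z i \<and> W \<subseteq> Z j \<and> ?\<tau> \<le> card U \<and> ?\<tau> \<le> card W \<longrightarrow> (\<exists>u\<in>U. \<epsilon> * card W \<le> card (nb \<kappa> u \<inter> W))"
        using same unfolding hered_dense_def by simp
    qed
  qed (use \<delta> in auto)
  then obtain \<phi> where \<phi>: "\<And>j. j < n \<Longrightarrow> \<phi> j \<in> Z j"
    and lt: "\<And>i j. j < n \<Longrightarrow> i < j \<Longrightarrow> \<phi> i \<noteq> \<phi> j \<and> (e (\<phi> i) (\<phi> j) \<longleftrightarrow> E i j) \<and> (E i j \<longrightarrow> (red (\<phi> i) (\<phi> j) \<longleftrightarrow> \<kappa>))"
    by blast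
  have ne: "\<phi> i \<noteq> \<phi> j \<and> (e (\<phi> i) (\<phi> j) \<longleftrightarrow> E i j) \<and> (E i j \<longrightarrow> (red (\<phi> i) (\<phi> j) \<longleftrightarrow> \<kappa>))"
    if "i < n" "j < n" "i \<noteq> j" for i j
    using lt [of i j] lt [of j i] that E_sym [of i j] e_sym [of "\<phi> i" "\<phi> j"] sym [of "\<phi> i" "\<phi> j"]
    by (cases "i < j") auto
  have "inj_on \<phi> {..<n}" using ne by (auto simp: inj_on_def)
  moreover have "\<phi> ` {..<n} \<subseteq> Pow {..<d}" using \<phi> Z(1) by (auto simp: V_def)
  moreover have "\<forall>i<n. \<forall>j<n. i \<noteq> j \<longrightarrow>
       (odd (card (\<phi> i \<inter> \<phi> j)) \<longleftrightarrow> E i j) \<and> (E i j \<longrightarrow> (red (\<phi> i) (\<phi> j) \<longleftrightarrow> \<kappa>))"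
    using ne by (auto simp: e_def)
  ultimately show ?thesis
    unfolding n_def [symmetric] d_def [symmetric] by (intro exI conjI)
qed

section \<open>From edge colourings to triangle colourings\<close>

lemma ex_inj_choice:
  assumes "finite B" "card B \<le> N" "\<And>b. b \<in> B \<Longrightarrow> N \<le> card (S b)"
  shows "\<exists>f. inj_on f B \<and> (\<forall>b\<in>B. f b \<in> S b)"
  using assms
proof (induction B rule: finite_induct)
  case empty
  then show ?case by simp
next
  case (insert b B)
  then obtain f where f: "inj_on f B" "\<forall>b\<in>B. f b \<in> S b" by auto
  have "card (f ` B) < card (S b)"
    using insert card_image_le [of B f] by (metis card_insert_disjoint insertI1 le_trans less_Suc_eq_le linorder_not_less)
  then have "\<not> S b \<subseteq> f ` B" using insert.hyps(1) card_mono [of "f ` B" "S b"] by auto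
  then obtain y where y: "y \<in> S b" "y \<notin> f ` B" by blast
  have "inj_on (f(b := y)) (insert b B)" "\<forall>c\<in>insert b B. (f(b := y)) c \<in> S c"
    using f y insert.hyps by (auto simp: inj_on_def)
  then show ?case by blast
qed

lemma card_cylinder_le:
  assumes "finite V" "P \<subseteq> V"
  shows "card {\<sigma> \<in> V \<rightarrow>\<^sub>E {..<q}. \<forall>l\<in>P. \<sigma> l = y l} \<le> q ^ (card V - card P)"
proof -
  have "inj_on (\<lambda>\<sigma>. restrict \<sigma> (V - P)) {\<sigma> \<in> V \<rightarrow>\<^sub>E {..<q}. \<forall>l\<in>P. \<sigma> l = y l}"
  proof (rule inj_onI)
    fix \<sigma> \<tau> assume *: "\<sigma> \<in> {\<sigma> \<in> V \<rightarrow>\<^sub>E {..<q}. \<forall>l\<in>P. \<sigma> l = y l}" "\<tau> \<in> {\<sigma> \<in> V \<rightarrow>\<^sub>E {..<q}. \<forall>l\<in>P. \<sigma> l = y l}"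
      and eq: "restrict \<sigma> (V - P) = restrict \<tau> (V - P)"
    show "\<sigma> = \<tau>"
    proof (rule PiE_ext)
      show "\<sigma> \<in> V \<rightarrow>\<^sub>E {..<q}" "\<tau> \<in> V \<rightarrow>\<^sub>E {..<q}" using * by auto
      fix l assume "l \<in> V"
      then show "\<sigma> l = \<tau> l" using * fun_cong [OF eq, of l] by (cases "l \<in> P") auto
    qed
  qed
  moreover have "(\<lambda>\<sigma>. restrict \<sigma> (V - P)) ` {\<sigma> \<in> V \<rightarrow>\<^sub>E {..<q}. \<forall>l\<in>P. \<sigma> l = y l} \<subseteq> (V - P) \<rightarrow>\<^sub>E {..<q}"
    by (auto intro!: restrict_PiE_iff [THEN iffD2])
  ultimately have "card {\<sigma> \<in> V \<rightarrow>\<^sub>E {..<q}. \<forall>l\<in>P. \<sigma> l = y l} \<le> card ((V - P) \<rightarrow>\<^sub>E {..<q})"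
    using assms by (intro card_inj_on_le) (auto intro: finite_PiE)
  then show ?thesis using assms by (simp add: card_funcsetE card_Diff_subset finite_subset)
qed

text \<open>Deleting from \<open>S\<close> every cylinder with few members removes only few elements.\<close>

lemma ex_transversal_all_patterns:
  fixes V :: "'l set" and S :: "('l \<Rightarrow> nat) set"
  assumes V: "finite V" and S: "S \<subseteq> V \<rightarrow>\<^sub>E {..<q}" and q: "0 < q"
    and large: "2 ^ card V * ((n + card V) * q ^ (card V - 1)) < card S"
  obtains x where "x \<in> S"
    "\<And>P. P \<subset> V \<Longrightarrow> n \<le> card {\<sigma> \<in> S. \<forall>l\<in>V. \<sigma> l = x l \<longleftrightarrow> l \<in> P}"
proof -
  define L where "L = card V"
  have finS: "finite S" using S V finite_PiE finite_subset by (metis finite_lessThan)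
  define cyl where "cyl P y = {\<sigma> \<in> S. restrict \<sigma> P = y}" for P y
  define small where "small P y = (if card (cyl P y) \<le> (n + L) * q ^ (L - card P - 1) then cyl P y else {})" for P y
  define Bad where "Bad = (\<Union>P\<in>Pow V - {V}. \<Union>y\<in>P \<rightarrow>\<^sub>E {..<q}. small P y)"
  have finP: "finite (P \<rightarrow>\<^sub>E {..<q})" if "P \<subseteq> V" for P
    using V that by (intro finite_PiE) (auto intro: finite_subset)
  \<comment> \<open>The \<open>q ^ card P\<close> cylinders over \<open>P\<close> lose at most
    \<open>(n + L) * q ^ (L - card P - 1)\<close> members each, so the total does not depend on
    \<open>P\<close>. As \<open>P\<close> is proper, the truncated subtraction is exact.\<close>
  have BadP: "card (\<Union>y\<in>P \<rightarrow>\<^sub>E {..<q}. small P y) \<le> (n + L) * q ^ (L - 1)" if P: "P \<in> Pow V - {V}" for P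
  proof -
    have cP: "card P < L" unfolding L_def using V P by (intro psubset_card_mono) auto
    have "card (\<Union>y\<in>P \<rightarrow>\<^sub>E {..<q}. small P y) \<le> (\<Sum>y\<in>P \<rightarrow>\<^sub>E {..<q}. card (small P y))"
      using finP P by (intro card_UN_le) auto
    also have "\<dots> \<le> (\<Sum>y\<in>P \<rightarrow>\<^sub>E {..<q}. (n + L) * q ^ (L - card P - 1))"
      by (rule sum_mono) (auto simp: small_def)
    also have "\<dots> = q ^ card P * ((n + L) * q ^ (L - card P - 1))"
      using P finite_subset [OF _ V, of P] by (simp add: card_funcsetE)
    also have "\<dots> = (n + L) * q ^ (card P + (L - card P - 1))" by (simp add: power_add)
    also have "card P + (L - card P - 1) = L - 1" using cP by simp
    finally show ?thesis .
  qed
  have "card Bad \<le> (\<Sum>P\<in>Pow V - {V}. card (\<Union>y\<in>P \<rightarrow>\<^sub>E {..<q}. small P y))"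
    unfolding Bad_def using V by (intro card_UN_le) auto
  also have "\<dots> \<le> (\<Sum>P\<in>Pow V - {V}. (n + L) * q ^ (L - 1))" by (rule sum_mono) (rule BadP)
  also have "\<dots> \<le> 2 ^ L * ((n + L) * q ^ (L - 1))"
    unfolding sum_constant using V by (intro mult_right_mono) (auto simp: card_Pow L_def card_Diff_subset)
  finally have "card Bad < card S" using large unfolding L_def by linarith
  moreover have "finite Bad"
    by (rule finite_subset [OF _ finS]) (auto simp: Bad_def small_def cyl_def split: if_splits)
  ultimately have "\<not> S \<subseteq> Bad" using card_mono [of Bad S] by force
  then obtain x where x: "x \<in> S" "x \<notin> Bad" by blast
  show ?thesis
  proof (rule that [OF x(1)])
    fix P assume P: "P \<subset> V"
    then have cP: "card P < L" unfolding L_def using V by (intro psubset_card_mono) auto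
    define y where "y = restrict x P"
    let ?X = "{\<sigma> \<in> S. \<forall>l\<in>V. \<sigma> l = x l \<longleftrightarrow> l \<in> P}"
    have yP: "y \<in> P \<rightarrow>\<^sub>E {..<q}" using x S P by (auto simp: y_def)
    have "x \<notin> small P y" using x(2) P yP by (auto simp: Bad_def)
    then have big: "(n + L) * q ^ (L - card P - 1) < card (cyl P y)"
      using x by (auto simp: small_def cyl_def y_def split: if_splits)
    \<comment> \<open>A member of the cylinder outside \<open>?X\<close> agrees with
      \<open>x\<close> at some further \<open>l\<close>. Such transversals account for at most the
      \<open>L\<close> in \<open>n + L\<close>, so the \<open>n\<close> remains for
      \<open>?X\<close>.\<close>
    have "cyl P y \<subseteq> ?X \<union> (\<Union>l\<in>V - P. {\<sigma> \<in> V \<rightarrow>\<^sub>E {..<q}. \<forall>m\<in>insert l P. \<sigma> m = x m})"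
    proof
      fix \<sigma> assume \<sigma>: "\<sigma> \<in> cyl P y"
      have eq: "\<sigma> m = x m" if "m \<in> P" for m
      proof -
        have "restrict \<sigma> P m = restrict x P m" using \<sigma> by (simp add: cyl_def y_def)
        then show ?thesis using that by simp
      qed
      show "\<sigma> \<in> ?X \<union> (\<Union>l\<in>V - P. {\<sigma> \<in> V \<rightarrow>\<^sub>E {..<q}. \<forall>m\<in>insert l P. \<sigma> m = x m})"
      proof (cases "\<exists>l\<in>V - P. \<sigma> l = x l")
        case True
        then obtain l where l: "l \<in> V - P" "\<sigma> l = x l" by blast
        have "\<sigma> \<in> {\<sigma> \<in> V \<rightarrow>\<^sub>E {..<q}. \<forall>m\<in>insert l P. \<sigma> m = x m}"
          using \<sigma> eq l S by (auto simp: cyl_def)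
        then show ?thesis using l(1) by blast
      next
        case False
        then have "\<sigma> \<in> ?X" using \<sigma> eq by (auto simp: cyl_def)
        then show ?thesis by blast
      qed
    qed
    then have "card (cyl P y) \<le> card (?X \<union> (\<Union>l\<in>V - P. {\<sigma> \<in> V \<rightarrow>\<^sub>E {..<q}. \<forall>m\<in>insert l P. \<sigma> m = x m}))"
      using finS V finP [of V] by (intro card_mono) (auto intro: finite_subset)
    also have "\<dots> \<le> card ?X + (\<Sum>l\<in>V - P. card {\<sigma> \<in> V \<rightarrow>\<^sub>E {..<q}. \<forall>m\<in>insert l P. \<sigma> m = x m})"
      using V by (intro order_trans [OF card_Un_le] add_left_mono card_UN_le) auto
    also have "\<dots> \<le> card ?X + (\<Sum>l\<in>V - P. q ^ (L - card P - 1))"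
    proof (intro add_left_mono sum_mono)
      fix l assume l: "l \<in> V - P"
      have "card (insert l P) = Suc (card P)" using l P V finite_subset by (metis DiffD2 card_insert_disjoint psubsetE)
      then show "card {\<sigma> \<in> V \<rightarrow>\<^sub>E {..<q}. \<forall>m\<in>insert l P. \<sigma> m = x m} \<le> q ^ (L - card P - 1)"
        using card_cylinder_le [OF V, of "insert l P" q x] l P by (simp add: L_def)
    qed
    also have "(\<Sum>l\<in>V - P. q ^ (L - card P - 1)) \<le> L * q ^ (L - card P - 1)"
      unfolding sum_constant L_def using V by (intro mult_right_mono card_mono) (auto intro: card_mono)
    finally have "n * q ^ (L - card P - 1) \<le> card ?X" using big by (simp add: add_mult_distrib)
    moreover have "n * 1 \<le> n * q ^ (L - card P - 1)" using q by (intro mult_left_mono) auto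
    ultimately show "n \<le> card ?X" by linarith
  qed
qed

section \<open>Induced copies and the Ramsey number\<close>

text \<open>Allows host graphs on any vertex type: \<open>G\<close> is copied into the natural
  numbers along an injection \<open>f\<close>, and colourings of the copy are pulled back along
  \<open>f\<close>.\<close>

lemma R_ind_triangle_le:
  fixes F :: "'a graph" and G :: "'b graph"
  assumes G: "fin_simple_graph G" and F: "fin_simple_graph F"
    and emb: "\<And>col :: 'b set \<Rightarrow> bool. \<exists>\<Phi> k. inj_on \<Phi> (verts F) \<and> \<Phi> ` verts F \<subseteq> verts G \<and>
      (\<forall>u\<in>verts F. \<forall>v\<in>verts F. u \<noteq> v \<longrightarrow> ({u, v} \<in> edges F \<longleftrightarrow> {\<Phi> u, \<Phi> v} \<in> edges G)) \<and>
      (\<forall>T\<in>triangles F. col (\<Phi> ` T) = k)"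
  shows "R_ind_triangle F \<le> enat (card (verts G))"
proof -
  obtain f :: "'b \<Rightarrow> nat" where f: "inj_on f (verts G)"
    using G ex_bij_betw_finite_nat unfolding fin_simple_graph_def bij_betw_def by meson
  define H :: "nat graph" where "H = (f ` verts G, (`) f ` edges G)"
  have eG: "e \<subseteq> verts G \<and> card e = 2" if "e \<in> edges G" for e
    using G that by (auto simp: fin_simple_graph_def nsets_def)
  have eF: "card e = 2" if "e \<in> edges F" for e
    using F that by (auto simp: fin_simple_graph_def nsets_def)
  have eH: "card e = 2" if e: "e \<in> edges H" for e
  proof -
    obtain e' where "e' \<in> edges G" "e = f ` e'" using e by (auto simp: H_def)
    then show ?thesis using eG [of e'] card_image [of f e'] f inj_on_subset by metis
  qed
  have H: "fin_simple_graph H"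
    unfolding fin_simple_graph_def
  proof
    show "finite (verts H)" using G by (simp add: fin_simple_graph_def H_def)
    show "edges H \<subseteq> [verts H]\<^bsup>2\<^esup>"
    proof
      fix e assume e: "e \<in> edges H"
      then have "e \<subseteq> verts H" using eG by (force simp: H_def)
      then show "e \<in> [verts H]\<^bsup>2\<^esup>" using eH [OF e] by (simp add: nsets_def card_ge_0_finite)
    qed
  qed
  have edge: "{f u, f v} \<in> edges H \<longleftrightarrow> {u, v} \<in> edges G" if "u \<in> verts G" "v \<in> verts G" for u v
  proof
    assume "{f u, f v} \<in> edges H"
    then obtain e where e: "e \<in> edges G" "f ` e = f ` {u, v}" by (auto simp: H_def)
    then have "e = {u, v}" using inj_on_image_eq_iff [OF f, of e "{u, v}"] eG that by auto
    then show "{u, v} \<in> edges G" using e by simp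
  next
    assume "{u, v} \<in> edges G"
    then have "f ` {u, v} \<in> edges H" unfolding H_def by (simp only: snd_conv) (rule imageI)
    then show "{f u, f v} \<in> edges H" by simp
  qed
  have "ind_triangle_arrow H F"
    unfolding ind_triangle_arrow_def
  proof
    fix col :: "nat set \<Rightarrow> bool"
    obtain \<Phi> k where \<Phi>: "inj_on \<Phi> (verts F) \<and> \<Phi> ` verts F \<subseteq> verts G \<and>
      (\<forall>u\<in>verts F. \<forall>v\<in>verts F. u \<noteq> v \<longrightarrow> ({u, v} \<in> edges F \<longleftrightarrow> {\<Phi> u, \<Phi> v} \<in> edges G)) \<and>
      (\<forall>T\<in>triangles F. col (f ` \<Phi> ` T) = k)"
      using emb [of "\<lambda>T. col (f ` T)"] by (elim exE) (rule that)
    have inj: "inj_on \<Phi> (verts F)" and sub: "\<Phi> ` verts F \<subseteq> verts G"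
      and k: "\<And>T. T \<in> triangles F \<Longrightarrow> col (f ` \<Phi> ` T) = k" using \<Phi> by simp_all
    have adj: "{u, v} \<in> edges F \<longleftrightarrow> {\<Phi> u, \<Phi> v} \<in> edges G"
      if "u \<in> verts F" "v \<in> verts F" "u \<noteq> v" for u v using \<Phi> that by simp
    let ?g = "f \<circ> \<Phi>"
    have g: "inj_on ?g (verts F)" using inj sub f by (meson comp_inj_on inj_on_subset)
    \<comment> \<open>\<open>graph_iso\<close> also compares pairs with \<open>u = v\<close>; these
      are singletons and hence edges of neither graph.\<close>
    have adj': "{?g u, ?g v} \<in> edges H \<longleftrightarrow> {u, v} \<in> edges F" if "u \<in> verts F" "v \<in> verts F" for u v
    proof (cases "u = v")
      case True
      then show ?thesis using eH [of "{?g v}"] eF [of "{v}"] by auto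
    next
      case False
      then show ?thesis using adj [OF that False] edge [of "\<Phi> u" "\<Phi> v"] sub that by auto
    qed
    define W where "W = ?g ` verts F"
    show "\<exists>W\<subseteq>verts H. graph_iso F (induced_subgraph H W) \<and>
       (\<exists>k. \<forall>T\<in>triangles (induced_subgraph H W). col T = k)"
    proof (intro exI conjI ballI)
      show "W \<subseteq> verts H" using sub by (auto simp: W_def H_def)
      show "graph_iso F (induced_subgraph H W)"
        unfolding graph_iso_def induced_subgraph_def
        using g adj' by (intro exI [of _ ?g]) (auto simp: bij_betw_def W_def)
      fix T assume T: "T \<in> triangles (induced_subgraph H W)"
      then have TW: "T \<subseteq> ?g ` verts F" "card T = 3" "clique T (edges H)"
        by (auto simp: triangles_def induced_subgraph_def nsets_def W_def clique_def)
      then obtain T0 where T0: "T0 \<subseteq> verts F" "T = ?g ` T0" by (meson subset_imageE)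
      have "card T0 = 3" using TW T0 card_image inj_on_subset g by metis
      moreover have "clique T0 (edges F)"
        unfolding clique_def
      proof (intro ballI impI)
        fix u v assume uv: "u \<in> T0" "v \<in> T0" "u \<noteq> v"
        then have "?g u \<noteq> ?g v" using g T0 by (meson inj_on_contraD subsetD)
        then have "{?g u, ?g v} \<in> edges H" using TW(3) T0 uv by (auto simp: clique_def)
        then show "{u, v} \<in> edges F" using adj' uv T0 by blast
      qed
      ultimately have "T0 \<in> triangles F"
        using T0 by (auto simp: triangles_def nsets_def intro: card_ge_0_finite)
      then show "col T = k" using k T0 by (simp add: image_comp)
    qed
  qed
  moreover have "card (verts H) = card (verts G)" using f by (simp add: H_def card_image)
  ultimately show ?thesis
    unfolding R_ind_triangle_def using H by (intro Inf_lower) blast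
qed

text \<open>Triangle-freeness of \<open>A\<close> provides a vertex \<open>b\<close> outside
  \<open>A\<close>, and independence of \<open>B\<close> then forces both of its neighbours into
  \<open>A\<close>.\<close>

lemma family_B_triangle:
  assumes "A \<union> B = verts F" "triangle_free (induced_subgraph F A)" "indep B (edges F)" "T \<in> triangles F"
  obtains a a' b where "a \<in> A" "a' \<in> A" "b \<in> B" "b \<notin> A" "a \<noteq> a'" "T = {b, a, a'}"
    "{a, b} \<in> edges F" "{a', b} \<in> edges F" "{a, a'} \<in> edges F"
proof -
  have T: "T \<subseteq> A \<union> B" "card T = 3" "clique T (edges F)" "finite T"
    using assms by (auto simp: triangles_def nsets_def)
  have "\<not> T \<subseteq> A"
  proof
    assume "T \<subseteq> A"
    then have "T \<in> triangles (induced_subgraph F A)"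
      using T by (auto simp: triangles_def induced_subgraph_def nsets_def clique_def)
    then show False using assms by (simp add: triangle_free_def)
  qed
  then obtain b where b: "b \<in> T" "b \<in> B" "b \<notin> A" using T by auto
  have "card (T - {b}) = 2" using T b by simp
  then obtain a a' where aa: "T - {b} = {a, a'}" "a \<noteq> a'" by (meson card_2_iff)
  then have mem: "a \<in> T" "a' \<in> T" "a \<noteq> b" "a' \<noteq> b" by auto
  then have ed: "{a, b} \<in> edges F" "{a', b} \<in> edges F" "{a, a'} \<in> edges F"
    using T(3) b aa by (auto simp: clique_def)
  then have "a \<notin> B" "a' \<notin> B" using assms(3) b mem by (auto simp: indep_def)
  then have "a \<in> A" "a' \<in> A" using T mem by auto
  moreover have "T = {b, a, a'}" using aa b by auto
  ultimately show ?thesis using that aa ed b by blast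
qed

section \<open>The blow-up with its transversals\<close>

definition lift_graph :: "'l set \<Rightarrow> ('l \<Rightarrow> 'l \<Rightarrow> bool) \<Rightarrow> nat \<Rightarrow> ('l \<times> nat + ('l \<Rightarrow> nat)) graph" where
  "lift_graph V e q = (Inl ` (V \<times> {..<q}) \<union> Inr ` (V \<rightarrow>\<^sub>E {..<q}),
     {{Inl (l, i), Inl (l', i')} | l i l' i'. l \<in> V \<and> l' \<in> V \<and> l \<noteq> l' \<and> i < q \<and> i' < q \<and> e l l'} \<union>
     {{Inl (l, \<sigma> l), Inr \<sigma>} | l \<sigma>. l \<in> V \<and> \<sigma> \<in> V \<rightarrow>\<^sub>E {..<q}})"

lemma fin_simple_lift_graph:
  assumes "finite V"
  shows "fin_simple_graph (lift_graph V e q)"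
proof -
  have "finite (V \<rightarrow>\<^sub>E {..<q})" using assms by (simp add: finite_PiE)
  then show ?thesis
    using assms unfolding fin_simple_graph_def lift_graph_def by (auto intro!: imageI dest: PiE_mem)
qed

lemma card_lift_graph:
  assumes "finite V"
  shows "card (verts (lift_graph V e q)) = card V * q + q ^ card V"
proof -
  have "finite (V \<rightarrow>\<^sub>E {..<q})" using assms by (simp add: finite_PiE)
  then have "card (verts (lift_graph V e q)) = card (Inl ` (V \<times> {..<q}) :: ('a \<times> nat + ('a \<Rightarrow> nat)) set) + card (Inr ` (V \<rightarrow>\<^sub>E {..<q}) :: ('a \<times> nat + ('a \<Rightarrow> nat)) set)"
    unfolding lift_graph_def fst_conv using assms by (intro card_Un_disjoint) auto
  then show ?thesis using assms by (simp add: card_image card_funcsetE card_cartesian_product)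
qed

lemma lift_graph_edges:
  assumes "\<And>l l'. e l l' \<longleftrightarrow> e l' l"
  shows "{Inl (l, i), Inl (l', i')} \<in> edges (lift_graph V e q) \<longleftrightarrow>
      l \<in> V \<and> l' \<in> V \<and> l \<noteq> l' \<and> i < q \<and> i' < q \<and> e l l'"
    and "{Inl (l, i), Inr \<sigma>} \<in> edges (lift_graph V e q) \<longleftrightarrow> l \<in> V \<and> \<sigma> \<in> V \<rightarrow>\<^sub>E {..<q} \<and> i = \<sigma> l"
    and "{Inr \<sigma>, Inr \<tau>} \<notin> edges (lift_graph V e q)"
  using assms unfolding lift_graph_def by (auto simp: doubleton_eq_iff)

text \<open>The bound on \<open>q\<close> pays for pigeonholing over the
  \<open>2 ^ (card V * card V)\<close> colour patterns and for the \<open>2 ^ card V\<close>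
  possible agreement sets. The condition \<open>n < card V\<close> makes the image of every
  neighbourhood a proper subset of \<open>V\<close>.\<close>

lemma R_ind_triangle_le_lift_graph:
  fixes F :: "'a graph" and V :: "'l set"
  assumes V: "finite V" "n < card V" and e_sym: "\<And>l l'. e l l' \<longleftrightarrow> e l' l"
    and q: "2 ^ (card V * card V + card V) * (n + card V) < q"
    and F: "F \<in> family_B m" and mn: "m \<le> n"
    and ramsey: "\<And>red (E :: nat \<Rightarrow> nat \<Rightarrow> bool). (\<And>l l'. red l l' \<longleftrightarrow> red l' l) \<Longrightarrow> (\<And>i j. E i j \<longleftrightarrow> E j i) \<Longrightarrow>
      \<exists>\<phi> \<kappa>. inj_on \<phi> {..<n} \<and> \<phi> ` {..<n} \<subseteq> V \<and> (\<forall>i<n. \<forall>j<n. i \<noteq> j \<longrightarrow>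
         (e (\<phi> i) (\<phi> j) \<longleftrightarrow> E i j) \<and> (E i j \<longrightarrow> (red (\<phi> i) (\<phi> j) \<longleftrightarrow> \<kappa>)))"
  shows "R_ind_triangle F \<le> enat (card (verts (lift_graph V e q)))"
proof -
  obtain A B where AB: "A \<union> B = verts F" "A \<inter> B = {}" "triangle_free (induced_subgraph F A)" "indep B (edges F)"
    and finF: "fin_simple_graph F" and cF: "card (verts F) = m"
    using F by (auto simp: family_B_def)
  have finAB: "finite A" "finite B" using AB(1) finF by (metis fin_simple_graph_def finite_Un)+
  have cAB: "card A \<le> n" "card B \<le> n"
  proof -
    have "card A \<le> card (verts F)" "card B \<le> card (verts F)"
      unfolding AB(1) [symmetric] using finAB by (simp_all add: card_mono)
    then show "card A \<le> n" "card B \<le> n" using cF mn by simp_all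
  qed
  define L where "L = card V"
  define \<Sigma> where "\<Sigma> = V \<rightarrow>\<^sub>E {..<q}"
  have fin\<Sigma>: "finite \<Sigma>" using V by (simp add: \<Sigma>_def finite_PiE)
  have q0: "0 < q" using q by linarith
  obtain g :: "'a \<Rightarrow> nat" where g: "bij_betw g A {0..<card A}" using ex_bij_betw_finite_nat finAB by blast
  then have g_inj: "inj_on g A" by (simp add: bij_betw_def)
  have gn: "g a < n" if "a \<in> A" for a using bij_betwE [OF g] that cAB(1) by fastforce
  \<comment> \<open>Indices from \<open>card A\<close> on act as isolated vertices, padding the
    target to the \<open>n\<close> vertices that \<open>ramsey\<close> expects.\<close>
  define E where "E i j \<longleftrightarrow> (\<exists>a\<in>A. \<exists>a'\<in>A. i = g a \<and> j = g a' \<and> {a, a'} \<in> edges F)" for i j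
  have E: "E (g a) (g a') \<longleftrightarrow> {a, a'} \<in> edges F" if "a \<in> A" "a' \<in> A" for a a'
    using that g_inj by (auto simp: E_def inj_on_eq_iff)
  have "E j i" if Eij: "E i j" for i j
  proof -
    obtain a a' where "a \<in> A" "a' \<in> A" "i = g a" "j = g a'" "{a', a} \<in> edges F"
      using Eij unfolding E_def by (auto simp: insert_commute)
    then show ?thesis unfolding E_def by blast
  qed
  then have E_sym: "E i j \<longleftrightarrow> E j i" for i j by blast
  show ?thesis
  proof (rule R_ind_triangle_le [OF fin_simple_lift_graph [OF V(1)] finF])
    fix col :: "('l \<times> nat + ('l \<Rightarrow> nat)) set \<Rightarrow> bool"
    \<comment> \<open>Values of \<open>col\<close> on sets that are no triangles are recorded too;
      this keeps the patterns in \<open>Pow (V \<times> V)\<close>.\<close>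
    define \<rho> where "\<rho> \<sigma> = {(l, l') \<in> V \<times> V. col {Inr \<sigma>, Inl (l, \<sigma> l), Inl (l', \<sigma> l')}}" for \<sigma>
    have "\<rho> \<in> \<Sigma> \<rightarrow> Pow (V \<times> V)" by (auto simp: \<rho>_def)
    then obtain R where R: "card \<Sigma> \<le> card (\<rho> -` {R} \<inter> \<Sigma>) * card (Pow (V \<times> V))"
      using pigeonhole_card [of \<rho> \<Sigma> "Pow (V \<times> V)"] fin\<Sigma> V by auto
    define S where "S = {\<sigma> \<in> \<Sigma>. \<rho> \<sigma> = R}"
    have "\<rho> -` {R} \<inter> \<Sigma> = S" by (auto simp: S_def)
    then have cS: "q ^ L \<le> card S * 2 ^ (L * L)"
      using R V by (simp add: \<Sigma>_def card_funcsetE card_Pow card_cartesian_product L_def)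
    have "2 ^ L * ((n + L) * q ^ (L - 1)) < card S"
    proof (rule ccontr)
      assume "\<not> 2 ^ L * ((n + L) * q ^ (L - 1)) < card S"
      then have "card S * 2 ^ (L * L) \<le> (2 ^ L * ((n + L) * q ^ (L - 1))) * 2 ^ (L * L)"
        by (intro mult_right_mono) auto
      also have "\<dots> = (2 ^ (L * L + L) * (n + L)) * q ^ (L - 1)" by (simp add: power_add)
      also have "\<dots> < q * q ^ (L - 1)" using q q0 by (intro mult_strict_right_mono) (auto simp: L_def)
      also have "\<dots> = q ^ L" using V(2) by (simp add: L_def power_eq_if)
      finally show False using cS by linarith
    qed
    then obtain x where x: "x \<in> S"
      and pat: "\<And>P. P \<subset> V \<Longrightarrow> n \<le> card {\<sigma> \<in> S. \<forall>l\<in>V. \<sigma> l = x l \<longleftrightarrow> l \<in> P}"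
      using ex_transversal_all_patterns [OF V(1) _ q0, of S n] by (auto simp: S_def \<Sigma>_def L_def)
    have S\<Sigma>: "\<sigma> \<in> V \<rightarrow>\<^sub>E {..<q}" if "\<sigma> \<in> S" for \<sigma> using that by (simp add: S_def \<Sigma>_def)
    have R_col: "(l, l') \<in> R \<longleftrightarrow> col {Inr \<sigma>, Inl (l, \<sigma> l), Inl (l', \<sigma> l')}"
      if "\<sigma> \<in> S" "l \<in> V" "l' \<in> V" for \<sigma> l l'
      using that by (auto simp: S_def \<rho>_def)
    have R_sym: "(l, l') \<in> R \<longleftrightarrow> (l', l) \<in> R" for l l'
      using x by (auto simp: S_def \<rho>_def insert_commute)
    obtain \<phi> \<kappa> where \<phi>: "inj_on \<phi> {..<n}" "\<phi> ` {..<n} \<subseteq> V"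
      and \<phi>E: "\<forall>i<n. \<forall>j<n. i \<noteq> j \<longrightarrow>
         (e (\<phi> i) (\<phi> j) \<longleftrightarrow> E i j) \<and> (E i j \<longrightarrow> ((\<phi> i, \<phi> j) \<in> R \<longleftrightarrow> \<kappa>))"
      using ramsey [of "\<lambda>l l'. (l, l') \<in> R" E, OF R_sym E_sym] by (elim exE conjE) (rule that)
    define f where "f a = \<phi> (g a)" for a
    have f_inj: "inj_on f A"
    proof (rule inj_onI)
      fix a a' assume a: "a \<in> A" "a' \<in> A" "f a = f a'"
      then have "g a = g a'" using inj_onD [OF \<phi>(1), of "g a" "g a'"] gn by (simp add: f_def)
      then show "a = a'" using inj_onD [OF g_inj] a by simp
    qed
    have fV: "f a \<in> V" if "a \<in> A" for a using \<phi>(2) gn [OF that] by (auto simp: f_def)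
    have fE: "(e (f a) (f a') \<longleftrightarrow> {a, a'} \<in> edges F) \<and> ({a, a'} \<in> edges F \<longrightarrow> ((f a, f a') \<in> R \<longleftrightarrow> \<kappa>))"
      if a: "a \<in> A" "a' \<in> A" "a \<noteq> a'" for a a'
    proof -
      have "g a \<noteq> g a'" using g_inj a by (meson inj_onD)
      then show ?thesis using \<phi>E gn [OF a(1)] gn [OF a(2)] E [OF a(1,2)] by (simp add: f_def)
    qed
    define nbr where "nbr b = f ` {a \<in> A. {a, b} \<in> edges F}" for b
    have nbrV: "nbr b \<subset> V" for b
    proof -
      have sub: "nbr b \<subseteq> f ` A" by (auto simp: nbr_def)
      have "card (nbr b) \<le> card (f ` A)" using finAB by (intro card_mono sub) auto
      also have "\<dots> \<le> card A" by (rule card_image_le [OF finAB(1)])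
      finally have "nbr b \<noteq> V" using cAB V by auto
      moreover have "f ` A \<subseteq> V" using fV by blast
      ultimately show ?thesis using sub by blast
    qed
    \<comment> \<open>Vertices of \<open>B\<close> may have equal neighbourhoods, so distinct
      transversals are needed; \<open>n\<close> candidates for each agreement set suffice for a
      greedy choice.\<close>
    obtain s where s: "inj_on s B" "\<And>b. b \<in> B \<Longrightarrow> s b \<in> {\<sigma> \<in> S. \<forall>l\<in>V. \<sigma> l = x l \<longleftrightarrow> l \<in> nbr b}"
      using ex_inj_choice [OF finAB(2) cAB(2), of "\<lambda>b. {\<sigma> \<in> S. \<forall>l\<in>V. \<sigma> l = x l \<longleftrightarrow> l \<in> nbr b}"] pat [OF nbrV] by auto
    have sS: "s b \<in> S" if "b \<in> B" for b using s(2) [OF that] by simp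
    have agree: "s b (f a) = x (f a) \<longleftrightarrow> {a, b} \<in> edges F" if "a \<in> A" "b \<in> B" for a b
    proof -
      have "s b (f a) = x (f a) \<longleftrightarrow> f a \<in> nbr b" using s(2) [OF that(2)] fV [OF that(1)] by simp
      also have "\<dots> \<longleftrightarrow> {a, b} \<in> edges F" using that f_inj by (auto simp: nbr_def inj_on_eq_iff)
      finally show ?thesis .
    qed
    have xq: "x l < q" if "l \<in> V" for l using S\<Sigma> [OF x] that by auto
    define \<Phi> where "\<Phi> v = (if v \<in> A then Inl (f v, x (f v)) else Inr (s v))" for v
    note adj = lift_graph_edges [of e, OF e_sym]
    show "\<exists>\<Phi> k. inj_on \<Phi> (verts F) \<and> \<Phi> ` verts F \<subseteq> verts (lift_graph V e q) \<and>
      (\<forall>u\<in>verts F. \<forall>v\<in>verts F. u \<noteq> v \<longrightarrow> ({u, v} \<in> edges F \<longleftrightarrow> {\<Phi> u, \<Phi> v} \<in> edges (lift_graph V e q))) \<and>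
      (\<forall>T\<in>triangles F. col (\<Phi> ` T) = k)"
    proof (intro exI conjI ballI impI)
      show "inj_on \<Phi> (verts F)"
      proof (rule inj_onI)
        fix u v assume uv: "u \<in> verts F" "v \<in> verts F" "\<Phi> u = \<Phi> v"
        show "u = v"
        proof (cases "u \<in> A")
          case True
          then show ?thesis using uv inj_onD [OF f_inj, of u v] by (simp add: \<Phi>_def split: if_splits)
        next
          case False
          then have "u \<in> B" "v \<in> B" "s u = s v" using uv AB(1) by (auto simp: \<Phi>_def split: if_splits)
          then show ?thesis using inj_onD [OF s(1)] by simp
        qed
      qed
      show "\<Phi> ` verts F \<subseteq> verts (lift_graph V e q)"
      proof
        fix y assume "y \<in> \<Phi> ` verts F"
        then obtain v where v: "v \<in> A \<or> v \<in> B" "y = \<Phi> v" unfolding AB(1) [symmetric] by blast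
        show "y \<in> verts (lift_graph V e q)"
        proof (cases "v \<in> A")
          case True
          then show ?thesis using v fV xq by (simp add: \<Phi>_def lift_graph_def)
        next
          case False
          then show ?thesis using v S\<Sigma> [OF sS, of v] by (simp add: \<Phi>_def lift_graph_def)
        qed
      qed
    next
      fix u v assume uv: "u \<in> verts F" "v \<in> verts F" "u \<noteq> v"
      have mem: "u \<in> A \<or> u \<in> B \<and> u \<notin> A" "v \<in> A \<or> v \<in> B \<and> v \<notin> A" using uv AB by auto
      have mixed: "{a, b} \<in> edges F \<longleftrightarrow> {\<Phi> a, \<Phi> b} \<in> edges (lift_graph V e q)" if "a \<in> A" "b \<in> B" "b \<notin> A" for a b
        using that agree [OF that(1,2)] fV S\<Sigma> [OF sS] by (auto simp: \<Phi>_def adj)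
      show "{u, v} \<in> edges F \<longleftrightarrow> {\<Phi> u, \<Phi> v} \<in> edges (lift_graph V e q)"
      proof (cases "u \<in> A"; cases "v \<in> A")
        assume "u \<in> A" "v \<in> A"
        moreover from this have "f u \<noteq> f v" using f_inj uv by (meson inj_onD)
        ultimately show ?thesis using fE [of u v] uv fV xq by (simp add: \<Phi>_def adj)
      next
        assume "u \<in> A" "v \<notin> A"
        then show ?thesis using mixed mem by blast
      next
        assume "u \<notin> A" "v \<in> A"
        then show ?thesis using mixed [of v u] mem by (simp add: insert_commute)
      next
        assume *: "u \<notin> A" "v \<notin> A"
        then have "{u, v} \<notin> edges F" using mem AB(4) uv by (auto simp: indep_def)
        then show ?thesis using * by (simp add: \<Phi>_def adj)
      qed
    next
      fix T assume "T \<in> triangles F"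
      then obtain a a' b where T: "a \<in> A" "a' \<in> A" "b \<in> B" "b \<notin> A" "a \<noteq> a'" "T = {b, a, a'}"
        "{a, b} \<in> edges F" "{a', b} \<in> edges F" "{a, a'} \<in> edges F"
        using family_B_triangle [OF AB(1,3,4)] by blast
      \<comment> \<open>Both \<open>a\<close> and \<open>a'\<close> are neighbours of
        \<open>b\<close>, so \<open>x\<close> may be replaced by \<open>s b\<close> here. The colour
        is then read off \<open>R\<close>, which is common to all members of
        \<open>S\<close>.\<close>
      have "\<Phi> ` T = {Inr (s b), Inl (f a, s b (f a)), Inl (f a', s b (f a'))}"
        using T agree [of a b] agree [of a' b] by (simp add: \<Phi>_def)
      then have "col (\<Phi> ` T) \<longleftrightarrow> (f a, f a') \<in> R"
        using R_col [OF sS fV fV, of b a a'] T by simp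
      then show "col (\<Phi> ` T) = \<kappa>" using fE [of a a'] T by simp
    qed
  qed
qed

section \<open>Size bounds\<close>

text \<open>The exponent \<open>5\<close> is crude:
  \<open>1 + 3 * L ^ 3 \<le> 4 * L ^ 3 \<le> L ^ 5\<close> for \<open>L \<ge> 2\<close>. With
  \<open>L = 2 ^ (200 * h * 2 ^ h)\<close> it yields the constant \<open>1000\<close> of the next
  lemma.\<close>

lemma lift_graph_size_bound:
  fixes L n q :: nat
  assumes "2 \<le> L" "n < L" "q = 2 ^ (3 * (L * L))"
  shows "2 ^ (L * L + L) * (n + L) < q" "L * q + q ^ L \<le> 2 ^ (L ^ 5)"
proof -
  have LL: "2 * L \<le> L * L" using assms by simp
  have "n + L < 2 * 2 ^ L" using assms less_exp [of L] by linarith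
  then have "2 ^ (L * L + L) * (n + L) < 2 ^ (L * L + L) * 2 ^ Suc L" by simp
  also have "\<dots> = 2 ^ (L * L + L + Suc L)" by (simp only: power_add)
  also have "\<dots> \<le> 2 ^ (3 * (L * L))"
  proof (rule power_increasing)
    show "L * L + L + Suc L \<le> 3 * (L * L)" using LL assms(1) by linarith
  qed simp
  finally show "2 ^ (L * L + L) * (n + L) < q" using assms by simp
  have "L \<le> 2 ^ L" by (simp add: less_imp_le less_exp)
  also have "\<dots> \<le> q"
    unfolding assms(3) using LL by (intro power_increasing) auto
  finally have "L * q \<le> q * q" by simp
  also have "\<dots> \<le> q ^ L" using assms power_increasing [of 2 L q] by (simp add: power2_eq_square)
  finally have "L * q + q ^ L \<le> 2 * q ^ L" by simp
  also have "\<dots> = 2 ^ (1 + 3 * (L * L) * L)" by (simp add: assms power_mult)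
  also have "\<dots> \<le> 2 ^ (L ^ 5)"
  proof (rule power_increasing)
    have "1 \<le> L * L * L" using assms by (simp add: Suc_leI)
    then have "1 + 3 * (L * L) * L \<le> 4 * (L * L * L)" by (simp add: mult.assoc)
    also have "\<dots> \<le> (L * L) * (L * L * L)" using assms mult_mono [of 2 L 2 L] by (intro mult_right_mono) auto
    finally show "1 + 3 * (L * L) * L \<le> L ^ 5" by (simp add: eval_nat_numeral mult_ac)
  qed simp
  finally show "L * q + q ^ L \<le> 2 ^ (L ^ 5)" .
qed

lemma R_ind_triangle_le_tower:
  fixes F :: "'a graph"
  assumes F: "F \<in> family_B m" and m: "m \<le> 2 ^ h" and h: "0 < h"
  shows "R_ind_triangle F \<le> enat (2 ^ (2 ^ (1000 * h * 2 ^ h)))"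
proof -
  define d where "d = 200 * h * 2 ^ h"
  define V where "V = Pow {..<d}"
  define L where "L = card V"
  define q :: nat where "q = 2 ^ (3 * (L * L))"
  have L: "L = 2 ^ d" by (simp add: L_def V_def card_Pow)
  have "h * 1 \<le> h * 2 ^ h" by (intro mult_left_mono) auto
  then have "h < d" using h unfolding d_def mult.assoc by linarith
  then have n: "2 ^ h < L" "2 \<le> L" using L power_increasing [of 1 d "2::nat"] by auto
  have "R_ind_triangle F \<le> enat (card (verts (lift_graph V (\<lambda>x y. odd (card (x \<inter> y))) q)))"
  proof (rule R_ind_triangle_le_lift_graph [OF _ _ _ _ F m])
    show "finite V" by (simp add: V_def)
    show "2 ^ h < card V" using n by (simp add: L_def)
    show "2 ^ (card V * card V + card V) * (2 ^ h + card V) < q"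
      using lift_graph_size_bound(1) [OF n(2,1) q_def] by (simp add: L_def)
    show "odd (card (l \<inter> l')) = odd (card (l' \<inter> l))" for l l' :: "nat set" by (simp add: Int_commute)
    show "\<exists>\<phi> \<kappa>. inj_on \<phi> {..<2 ^ h} \<and> \<phi> ` {..<2 ^ h} \<subseteq> V \<and>
         (\<forall>i<2 ^ h. \<forall>j<2 ^ h. i \<noteq> j \<longrightarrow>
            (odd (card (\<phi> i \<inter> \<phi> j)) \<longleftrightarrow> E i j) \<and> (E i j \<longrightarrow> (red (\<phi> i) (\<phi> j) \<longleftrightarrow> \<kappa>)))"
      if "\<And>l l'. red l l' \<longleftrightarrow> red l' l" "\<And>i j. E i j \<longleftrightarrow> E j i" for red :: "nat set \<Rightarrow> nat set \<Rightarrow> bool" and E :: "nat \<Rightarrow> nat \<Rightarrow> bool"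
      using induced_ramsey_parity_graph [OF h, of red E] that unfolding V_def d_def by blast
  qed
  also have "card (verts (lift_graph V (\<lambda>x y. odd (card (x \<inter> y))) q)) = L * q + q ^ L"
    by (simp add: card_lift_graph V_def L_def)
  also have "enat (L * q + q ^ L) \<le> enat (2 ^ (L ^ 5))"
    using lift_graph_size_bound(2) [OF n(2,1) q_def] by simp
  also have "L ^ 5 = 2 ^ (1000 * h * 2 ^ h)" by (simp add: L d_def flip: power_mult)
  finally show ?thesis .
qed

text \<open>With at most one vertex there are no triangles, so \<open>F\<close> serves as its own
  host.\<close>

lemma R_ind_triangle_small:
  fixes F :: "'a graph"
  assumes F: "F \<in> family_B m" and m: "m \<le> 1"
  shows "R_ind_triangle F \<le> 1"
proof -
  have fin: "fin_simple_graph F" and c: "card (verts F) = m" using F by (auto simp: family_B_def)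
  have "triangles F = {}"
  proof -
    have "finite (verts F)" using fin by (simp add: fin_simple_graph_def)
    then have "[verts F]\<^bsup>3\<^esup> = {}" using c m by (simp add: nsets_eq_empty)
    then show ?thesis by (simp add: triangles_def)
  qed
  then have "R_ind_triangle F \<le> enat (card (verts F))"
    by (intro R_ind_triangle_le fin exI [of _ id]) auto
  also have "\<dots> \<le> 1" using c m by (simp add: one_enat_def)
  finally show ?thesis .
qed

theorem theorem1p2:
  shows "\<exists>c::real. c > 0 \<and>
    (\<forall>n::nat. \<forall>F :: nat graph. F \<in> family_B n \<longrightarrow>
      ereal_of_enat (R_ind_triangle F)
        \<le> ereal (2 powr (2 powr (c * real n * ln (real n)))))"
proof (intro exI conjI allI impI)
  \<comment> \<open>Bounding \<open>1000 * h * 2 ^ h\<close> by \<open>2 ^ h \<le> 2 * n\<close> and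
    \<open>h * ln 2 \<le> 2 * ln n\<close> gives \<open>4000 / ln 2\<close>.\<close>
  show "4000 / ln 2 > (0::real)" by simp
  fix n :: nat and F :: "nat graph"
  assume F: "F \<in> family_B n"
  show "ereal_of_enat (R_ind_triangle F) \<le> ereal (2 powr (2 powr (4000 / ln 2 * real n * ln (real n))))"
  proof (cases "n \<le> 1")
    case True
    have "ereal_of_enat (R_ind_triangle F) \<le> ereal_of_enat 1"
      using R_ind_triangle_small [OF F True] by simp
    also have "\<dots> = ereal 1" by (simp add: one_enat_def)
    \<comment> \<open>The outer exponent is a power of \<open>2\<close> and hence nonnegative,
      whatever the value of \<open>ln 0\<close>.\<close>
    also have "ereal 1 \<le> ereal (2 powr (2 powr (4000 / ln 2 * real n * ln (real n))))"
      by (simp add: ge_one_powr_ge_zero)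
    finally show ?thesis .
  next
    case False
    then have n: "2 \<le> n" by simp
    \<comment> \<open>Minimality of \<open>h\<close> yields \<open>2 ^ (h - 1) < n\<close>, from
      which both bounds on \<open>h\<close> follow.\<close>
    define h where "h = (LEAST h. n \<le> 2 ^ h)"
    have nh: "n \<le> 2 ^ h" unfolding h_def by (rule LeastI [of _ n]) (simp add: less_imp_le less_exp)
    have h0: "0 < h" using nh n by (cases h) auto
    then have "\<not> n \<le> 2 ^ (h - 1)" unfolding h_def by (intro not_less_Least) simp
    then have lt: "2 ^ (h - 1) < n" by simp
    have two: "2 ^ h \<le> 2 * n" using lt h0 by (cases h) auto
    have "real (2 ^ (h - 1)) \<le> real n" using lt by (simp only: of_nat_le_iff less_imp_le)
    then have "ln (2 ^ (h - 1)) \<le> ln (real n)" using n by (subst ln_le_cancel_iff) auto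
    then have "real (h - 1) * ln 2 \<le> ln (real n)" by (simp add: ln_realpow)
    then have "(real h - 1) * ln 2 \<le> ln (real n)" using h0 by (simp add: of_nat_diff)
    moreover have "ln 2 \<le> ln (real n)" using n by simp
    ultimately have hln: "real h * ln 2 \<le> 2 * ln (real n)" by (simp add: algebra_simps)
    have "real (2 ^ h) \<le> real (2 * n)" using two by (simp only: of_nat_le_iff)
    then have two': "1000 * (2::real) ^ h \<le> 1000 * (2 * real n)" by simp
    have "real (1000 * h * 2 ^ h) * ln 2 = 1000 * 2 ^ h * (real h * ln 2)" by simp
    also have "\<dots> \<le> 1000 * (2 * real n) * (2 * ln (real n))"
      by (rule mult_mono [OF two' hln]) auto
    finally have exponent: "real (1000 * h * 2 ^ h) \<le> 4000 / ln 2 * real n * ln (real n)"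
      by (simp add: pos_le_divide_eq mult_ac)
    define k where "k = 1000 * h * 2 ^ h"
    have "ereal_of_enat (R_ind_triangle F) \<le> ereal_of_enat (enat (2 ^ (2 ^ k)))"
      using R_ind_triangle_le_tower [OF F nh h0] unfolding k_def by (simp only: ereal_of_enat_le_iff)
    also have "\<dots> = ereal (2 ^ (2 ^ k))" by simp
    also have "(2::real) ^ (2 ^ k) = 2 powr real (2 ^ k)" by (rule powr_realpow [symmetric]) simp
    also have "real (2 ^ k) = 2 powr real k" by (simp add: powr_realpow)
    also have "ereal (2 powr (2 powr real k)) \<le> ereal (2 powr (2 powr (4000 / ln 2 * real n * ln (real n))))"
      using exponent unfolding k_def [symmetric] by (simp add: powr_mono)
    finally show ?thesis .
  qed
qed

end
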